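(* Let $p$ be a prime, $q=p$, $n\ge2$ and $k\ge1$ integers, $d=\gcd(k,p-1)$, $d_n=\gcd(k,p^n-1)$. Suppose $p>d+1$ and $p\nmid k$. Then every matrix in $M_n(\mathbb F_p)$ is of the form $A^k+B^k$ with $A,B\in M_n(\mathbb F_p)$ provided $n>\max\left\{\frac{p-1}{2},\frac{4\ln(k-1)}{\ln p}\right\}$; and every matrix in $M_n(\mathbb F_p)$ is of the form $A^k+B^k$ with $A,B\in GL_n(\mathbb F_p)$ provided $n>\max\left\{\frac{p-1}{2},\frac{\ln((k-1)^4+4k)}{\ln p}\right\}$ and $p\frac{p^n-1}{d_n}$ is even.
   Context: Convention: $\ln(0)=-\infty$ (relevant when $k=1$). *)

theory Defs
  imports
    "Berlekamp_Zassenhaus.Finite_Field"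
    "Jordan_Normal_Form.Matrix"
    "HOL-Library.Extended_Real"
begin

text \<open>
  The natural logarithm on the nonnegative reals with the convention that its value at 0 is
  minus infinity (the library has \<open>ln 0 = 0\<close>).
\<close>

definition ln_ext :: "real \<Rightarrow> ereal" where
  "ln_ext x = (if x = 0 then - \<infinity> else ereal (ln x))"

end

theory Submission
  imports "HOL-Algebra.Algebraic_Closure_Type" "HOL-Analysis.Convex"
    "Jordan_Normal_Form.Column_Operations" "Jordan_Normal_Form.Determinant" Defs
begin

text \<open>
  Since \<open>d < p - 1\<close>, the prime field contains a \<open>k\<close>-th power \<open>h \<noteq> 0, 1\<close>. A nonscalar matrix is
  similar to one with any prescribed diagonal of the right trace; as \<open>2 * n \<ge> p\<close>, every trace is a
  sum of \<open>2 * n\<close> numbers from \<open>{1, h}\<close>, so the matrix is similar to the sum of an upper and a lower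
  triangular matrix with diagonal entries in \<open>{1, h}\<close>. Such triangular matrices are \<open>k\<close>-th powers by
  Newton iteration in \<open>F\<^sub>p[x]\<close> modulo powers of \<open>(x - 1)(x - h)\<close>, because \<open>k\<close> is invertible.

  For a scalar \<open>c\<close> it suffices, by the regular representation of the field with \<open>q = p ^ n\<close> elements,
  to solve \<open>x ^ k + y ^ k = c\<close> there. The number of solutions is estimated with the sums
  \<open>T(a) = (\<Sum>x. \<psi> (a * x ^ k))\<close> over an additive character \<open>\<psi>\<close>, using only their first two moments
  and their invariance under \<open>a \<mapsto> a * z ^ k\<close>.
\<close>

section \<open>Similarity to a matrix with prescribed diagonal\<close>

text \<open>A scalar matrix is similar only to itself, so its diagonal cannot be rearranged; this is
  why two unrelated arguments are needed. For nonscalar matrices the attainable traces are 2n + j(h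
  - 1) with 0 \<le> j \<le> 2n, and h - 1 is invertible, so they cover F_p as soon as j may run over
  all residues: the origin of (p - 1)/2. The triangular summands have nonzero determinant, hence
  this half already yields invertible A and B, and the logarithmic bounds and the parity condition
  concern scalars only. For c \<noteq> 0 the number of solutions is q up to an error of order E^2
  sqrt q, where E + 1 is the number of k-th roots of unity in the field. Since E \<le> k - 1, it is
  positive once q > (k - 1)^4, which is the bound 4 ln(k - 1)/ln p. At most 2(E + 1) \<le> 2k
  solutions have a zero coordinate; discarding them costs the summand 4k. For c = 0 a solution with
  x, y \<noteq> 0 exists only if -1 is a k-th power, and this is what the parity condition
  provides.\<close>

definition similar_fixing :: "nat \<Rightarrow> nat \<Rightarrow> 'a::comm_ring_1 mat \<Rightarrow> 'a mat \<Rightarrow> bool" where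
  "similar_fixing n r A B \<longleftrightarrow> A \<in> carrier_mat n n \<and> B \<in> carrier_mat n n \<and> similar_mat B A \<and>
     (\<Sum>i<n. B $$ (i,i)) = (\<Sum>i<n. A $$ (i,i)) \<and> (\<forall>i<r. B $$ (i,i) = A $$ (i,i))"

lemma similar_fixing_refl: "A \<in> carrier_mat n n \<Longrightarrow> similar_fixing n r A A"
  by (auto simp: similar_fixing_def intro: similar_mat_refl)

lemma similar_fixing_trans:
  "similar_fixing n r A B \<Longrightarrow> similar_fixing n r B C \<Longrightarrow> similar_fixing n r A C"
  unfolding similar_fixing_def by (metis similar_mat_trans)

lemma similar_fixing_mono: "similar_fixing n r A B \<Longrightarrow> s \<le> r \<Longrightarrow> similar_fixing n s A B"
  by (auto simp: similar_fixing_def)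

text \<open>\<open>add_col_sub_row t k l\<close> subtracts \<open>t\<close> times row
  \<open>l\<close> from row \<open>k\<close> and adds \<open>t\<close> times column \<open>k\<close>
  to column \<open>l\<close>, so the amount \<open>t * A $$ (l,k)\<close> moves from diagonal place
  \<open>k\<close> to place \<open>l\<close>. Every conjugation in this section is of this
  form.\<close>

lemma similar_fixing_add_col_sub_row:
  assumes A: "A \<in> carrier_mat n n" and kl: "k < n" "l < n" "k \<noteq> l" "r \<le> k" "r \<le> l"
  shows "similar_fixing n r A (add_col_sub_row t k l A)"
proof -
  have "(\<Sum>i<n. add_col_sub_row t k l A $$ (i,i)) =
        (\<Sum>i<n. A $$ (i,i) + (if i = k then - t * A $$ (l,k) else 0) + (if i = l then t * A $$ (l,k) else 0))"
    by (rule sum.cong) (use A kl in auto)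
  also have "\<dots> = (\<Sum>i<n. A $$ (i,i))"
    using kl by (simp add: sum.distrib)
  finally show ?thesis
    using A kl add_col_sub_row_similar[OF A kl(1-3)] unfolding similar_fixing_def by auto
qed

text \<open>An entry of column \<open>r\<close> below the diagonal will be the pivot for changing
  the diagonal entry at \<open>r\<close>. Adding column \<open>b\<close> to column \<open>r\<close>
  brings the given entry there unless it lies in row \<open>r\<close> itself.\<close>

lemma obtain_nonzero_in_column:
  fixes A :: "'a::field mat"
  assumes A: "A \<in> carrier_mat n n" and two: "(2::'a) \<noteq> 0"
    and ab: "r \<le> a" "a < n" "r \<le> b" "b < n" "a \<noteq> b" "A $$ (a,b) \<noteq> 0"
  obtains B j where "similar_fixing n r A B" "r < j" "j < n" "B $$ (j,r) \<noteq> 0"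
proof -
  have r: "r < n" using ab by auto
  consider "b = r" | "b \<noteq> r" "a \<noteq> r" "A $$ (a,r) \<noteq> 0" | "b \<noteq> r" "a \<noteq> r" "A $$ (a,r) = 0"
    | "a = r" "A $$ (b,r) \<noteq> 0" | "a = r" "A $$ (b,r) = 0" by blast
  then show ?thesis
  proof cases
    case 1
    with ab show ?thesis by (intro that[OF similar_fixing_refl[OF A], of a]) auto
  next
    case 2
    with ab show ?thesis by (intro that[OF similar_fixing_refl[OF A], of a]) auto
  next
    case 3
    show ?thesis
      by (rule that[OF similar_fixing_add_col_sub_row[OF A, of b r r 1], of a]) (use ab A r 3 in auto)
  next
    case 4
    with ab show ?thesis by (intro that[OF similar_fixing_refl[OF A], of b]) auto
  next
    case 5
    \<comment> \<open>The new entry at \<open>(b,r)\<close> is \<open>t\<close> times a linear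
      polynomial in \<open>t\<close>; if it vanished for both \<open>1\<close> and
      \<open>-1\<close>, then \<open>2 * A $$ (r,b)\<close> would be 0.\<close>
    define t where "t = (if A $$ (b,b) - A $$ (r,r) = A $$ (r,b) then -1 else 1::'a)"
    have "A $$ (r,b) \<noteq> - A $$ (r,b)"
    proof
      assume "A $$ (r,b) = - A $$ (r,b)"
      then have "2 * A $$ (r,b) = 0" by (simp add: eq_neg_iff_add_eq_0)
      with two ab 5 show False by simp
    qed
    then have "t \<noteq> 0" "A $$ (b,b) - A $$ (r,r) - t * A $$ (r,b) \<noteq> 0"
      by (auto simp: t_def)
    then have "t * (A $$ (b,b) - A $$ (r,r) - t * A $$ (r,b)) \<noteq> 0" by simp
    moreover have "add_col_sub_row t b r A $$ (b,r) = t * (A $$ (b,b) - A $$ (r,r) - t * A $$ (r,b))"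
      using ab A r 5 by (simp add: algebra_simps)
    ultimately show ?thesis
      using ab A r 5
      by (intro that[OF similar_fixing_add_col_sub_row[OF A, of b r r t], of b]) auto
  qed
qed

lemma prescribe_diagonal_entry:
  fixes A :: "'a::field mat"
  assumes A: "A \<in> carrier_mat n n" and two: "(2::'a) \<noteq> 0"
    and ab: "r \<le> a" "a < n" "r \<le> b" "b < n" "a \<noteq> b" "A $$ (a,b) \<noteq> 0"
  obtains B where "similar_fixing n r A B" "B $$ (r,r) = c"
    "r + 2 < n \<longrightarrow> (\<exists>a b. r < a \<and> a < n \<and> r < b \<and> b < n \<and> a \<noteq> b \<and> B $$ (a,b) \<noteq> 0)"
proof -
  obtain B j where B: "similar_fixing n r A B" and j: "r < j" "j < n" "B $$ (j,r) \<noteq> 0"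
    using obtain_nonzero_in_column[OF assms] .
  have Bc: "B \<in> carrier_mat n n" using B by (simp add: similar_fixing_def)
  have r: "r < n" using j by simp
  \<comment> \<open>Before the pivot is used, row \<open>j\<close> gets a nonzero entry in a further
    column \<open>l\<close>. The last conjugation alters only row \<open>r\<close> and column
    \<open>j\<close>, so this entry survives and serves as the off-diagonal entry for the next
    step.\<close>
  obtain C l where C: "similar_fixing n r B C" "C $$ (j,r) \<noteq> 0"
    and l: "r + 2 < n \<Longrightarrow> r < l \<and> l < n \<and> l \<noteq> j \<and> C $$ (j,l) \<noteq> 0"
  proof (cases "r + 2 < n")
    case False
    then show ?thesis by (intro that[OF similar_fixing_refl[OF Bc]]) (use j in auto)
  next
    case True
    define l where "l = (if j = r + 1 then r + 2 else r + 1)"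
    have l: "r < l" "l < n" "l \<noteq> j" using True by (auto simp: l_def)
    show ?thesis
    proof (cases "B $$ (j,l) = 0")
      case False
      then show ?thesis by (intro that[OF similar_fixing_refl[OF Bc], of l]) (use j l in auto)
    next
      case True
      show ?thesis
        by (rule that[OF similar_fixing_add_col_sub_row[OF Bc, of r l r 1], of l])
          (use j l r Bc True in auto)
    qed
  qed
  have Cc: "C \<in> carrier_mat n n" using C by (simp add: similar_fixing_def)
  define t where "t = (C $$ (r,r) - c) / C $$ (j,r)"
  have "similar_fixing n r A (add_col_sub_row t r j C)"
    using similar_fixing_trans[OF similar_fixing_trans[OF B C(1)]
        similar_fixing_add_col_sub_row[OF Cc, of r j r t]] j by simp
  moreover have "add_col_sub_row t r j C $$ (r,r) = c"
    using j r Cc C(2) by (simp add: t_def)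
  moreover have "\<exists>a b. r < a \<and> a < n \<and> r < b \<and> b < n \<and> a \<noteq> b \<and> add_col_sub_row t r j C $$ (a,b) \<noteq> 0"
    if "r + 2 < n"
    by (rule exI[of _ j], rule exI[of _ l]) (use j r Cc l[OF that] in auto)
  ultimately show ?thesis using that by blast
qed

text \<open>A diagonal matrix that is not scalar has two distinct diagonal entries, and one
  elementary conjugation makes their difference an off-diagonal entry.\<close>

lemma nonscalar_similar_offdiag:
  fixes A :: "'a::field mat"
  assumes A: "A \<in> carrier_mat n n" and ns: "\<And>c. A \<noteq> c \<cdot>\<^sub>m 1\<^sub>m n"
  obtains B a b where "similar_fixing n 0 A B" "a < n" "b < n" "a \<noteq> b" "B $$ (a,b) \<noteq> 0"
proof (cases "\<exists>a b. a < n \<and> b < n \<and> a \<noteq> b \<and> A $$ (a,b) \<noteq> 0")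
  case True
  with similar_fixing_refl[OF A] that show ?thesis by blast
next
  case False
  have "\<exists>a<n. A $$ (a,a) \<noteq> A $$ (0,0)"
  proof (rule ccontr)
    define c where "c = A $$ (0,0)"
    assume "\<not> ?thesis"
    then have "\<forall>a<n. A $$ (a,a) = c" unfolding c_def by blast
    then have "A = c \<cdot>\<^sub>m 1\<^sub>m n"
      using A False by (intro eq_matI) auto
    with ns show False by blast
  qed
  then obtain a where a: "a < n" "A $$ (a,a) \<noteq> A $$ (0,0)" by blast
  then have "a \<noteq> 0" by metis
  moreover have "A $$ (a,0) = 0" "A $$ (0,a) = 0" using a False \<open>a \<noteq> 0\<close> by auto
  ultimately show ?thesis
    using a A by (intro that[OF similar_fixing_add_col_sub_row[OF A, of a 0 0 1], of a 0]) auto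
qed

text \<open>Entries are fixed from the top, and the invariant keeps an off-diagonal entry in the
  trailing block while that block has size at least 2. The last entry cannot be chosen but is forced
  by the trace, so the induction stops at \<open>n - 1\<close>.\<close>

lemma nonscalar_similar_prescribed_diagonal:
  fixes A :: "'a::field mat"
  assumes A: "A \<in> carrier_mat n n" and ns: "\<And>c. A \<noteq> c \<cdot>\<^sub>m 1\<^sub>m n" and two: "(2::'a) \<noteq> 0"
    and tr: "(\<Sum>i<n. c i) = (\<Sum>i<n. A $$ (i,i))"
  obtains B where "B \<in> carrier_mat n n" "similar_mat B A" "\<forall>i<n. B $$ (i,i) = c i"
proof -
  have main: "\<exists>B. similar_fixing n 0 A B \<and> (\<forall>i<r. B $$ (i,i) = c i) \<and>
     (r + 1 < n \<longrightarrow> (\<exists>a b. r \<le> a \<and> a < n \<and> r \<le> b \<and> b < n \<and> a \<noteq> b \<and> B $$ (a,b) \<noteq> 0))"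
    if "r < n" for r
    using that
  proof (induction r)
    case 0
    obtain B a b where "similar_fixing n 0 A B" "a < n" "b < n" "a \<noteq> b" "B $$ (a,b) \<noteq> 0"
      using nonscalar_similar_offdiag[OF A ns] .
    then show ?case by auto
  next
    case (Suc r)
    then obtain B a b where B: "similar_fixing n 0 A B" "\<forall>i<r. B $$ (i,i) = c i"
      and ab: "r \<le> a" "a < n" "r \<le> b" "b < n" "a \<noteq> b" "B $$ (a,b) \<noteq> 0" by auto
    have Bc: "B \<in> carrier_mat n n" using B by (simp add: similar_fixing_def)
    obtain C where C: "similar_fixing n r B C" "C $$ (r,r) = c r"
      "r + 2 < n \<longrightarrow> (\<exists>a b. r < a \<and> a < n \<and> r < b \<and> b < n \<and> a \<noteq> b \<and> C $$ (a,b) \<noteq> 0)"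
      using prescribe_diagonal_entry[OF Bc two ab, where c = "c r"] .
    have "similar_fixing n 0 A C"
      using similar_fixing_trans[OF B(1) similar_fixing_mono[OF C(1)]] by simp
    moreover have "\<forall>i<Suc r. C $$ (i,i) = c i"
      using B(2) C(1,2) by (auto simp: similar_fixing_def less_Suc_eq)
    ultimately show ?case using C(3) by (auto simp: Suc_le_eq)
  qed
  show ?thesis
  proof (cases n)
    case 0
    then show ?thesis using that[OF A similar_mat_refl[OF A]] by simp
  next
    case (Suc m)
    from main[of m] Suc obtain B where B: "similar_fixing n 0 A B" "\<forall>i<m. B $$ (i,i) = c i" by auto
    then have "(\<Sum>i<n. B $$ (i,i)) = (\<Sum>i<n. c i)" using tr by (simp add: similar_fixing_def)
    moreover have "(\<Sum>i<m. B $$ (i,i)) = (\<Sum>i<m. c i)" using B(2) by simp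
    ultimately have "B $$ (m,m) = c m" using Suc by simp
    with B Suc show ?thesis
      by (intro that[of B]) (auto simp: similar_fixing_def less_Suc_eq)
  qed
qed

section \<open>Roots of triangular matrices\<close>

definition eval_mat :: "nat \<Rightarrow> 'a::comm_ring_1 poly \<Rightarrow> 'a mat \<Rightarrow> 'a mat" where
  "eval_mat n p A = fold_coeffs (\<lambda>a M. a \<cdot>\<^sub>m 1\<^sub>m n + A * M) p (0\<^sub>m n n)"

lemma eval_mat_0 [simp]: "eval_mat n 0 A = 0\<^sub>m n n"
  by (simp add: eval_mat_def)

context
  fixes A :: "'a::comm_ring_1 mat" and n :: nat
  assumes A [simp]: "A \<in> carrier_mat n n"
begin

lemma dim_A [simp]: "dim_row A = n" "dim_col A = n"
  using carrier_matD[OF A] .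

lemma eval_mat_pCons: "eval_mat n (pCons a p) A = a \<cdot>\<^sub>m 1\<^sub>m n + A * eval_mat n p A"
proof (cases "p = 0 \<and> a = 0")
  case True
  have "(0::'a) \<cdot>\<^sub>m 1\<^sub>m n + A * 0\<^sub>m n n = 0\<^sub>m n n" by (intro eq_matI) auto
  with True show ?thesis by simp
next
  case False
  then show ?thesis
    by (cases "p = 0") (simp_all add: eval_mat_def fold_coeffs_pCons_not_0_0_eq fold_coeffs_pCons_coeff_not_0_eq)
qed

lemma eval_mat_carrier [simp]: "eval_mat n p A \<in> carrier_mat n n"
  by (induction p) (auto simp: eval_mat_pCons intro!: add_carrier_mat mult_carrier_mat[OF A])

lemma dim_eval_mat [simp]: "dim_row (eval_mat n p A) = n" "dim_col (eval_mat n p A) = n"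
  using carrier_matD[OF eval_mat_carrier] .

lemma eval_mat_add: "eval_mat n (p + q) A = eval_mat n p A + eval_mat n q A"
proof (induction p q rule: poly_induct2)
  case (pCons a p b q)
  have "A * (eval_mat n p A + eval_mat n q A) = A * eval_mat n p A + A * eval_mat n q A"
    by (rule mult_add_distrib_mat[of _ n n _ n]) auto
  then show ?case using pCons
    by (auto simp: eval_mat_pCons add_smult_distrib_right_mat[of _ n n] intro!: eq_matI)
qed auto

lemma eval_mat_smult: "eval_mat n (smult c p) A = c \<cdot>\<^sub>m eval_mat n p A"
proof (induction p)
  case 0
  show ?case by (auto intro!: eq_matI)
next
  case (pCons a p)
  have "A * (c \<cdot>\<^sub>m eval_mat n p A) = c \<cdot>\<^sub>m (A * eval_mat n p A)"
    by (rule mult_smult_distrib[of _ n n _ n]) auto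
  then show ?case using pCons
    by (auto simp: eval_mat_pCons algebra_simps intro!: eq_matI)
qed

lemma eval_mat_mult: "eval_mat n (p * q) A = eval_mat n p A * eval_mat n q A"
proof (induction p)
  case 0
  have "0\<^sub>m n n * eval_mat n q A = 0\<^sub>m n n" by (rule left_mult_zero_mat[of _ _ n]) simp
  then show ?case by simp
next
  case (pCons a p)
  have "(a \<cdot>\<^sub>m 1\<^sub>m n + A * eval_mat n p A) * eval_mat n q A =
        a \<cdot>\<^sub>m 1\<^sub>m n * eval_mat n q A + A * eval_mat n p A * eval_mat n q A"
    by (rule add_mult_distrib_mat[of _ n n _ _ n]) (auto intro: mult_carrier_mat[OF A])
  also have "a \<cdot>\<^sub>m 1\<^sub>m n * eval_mat n q A = a \<cdot>\<^sub>m eval_mat n q A"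
    by (subst mult_smult_assoc_mat[of _ n n _ n]) (auto simp: left_mult_one_mat[of _ n n])
  also have "A * eval_mat n p A * eval_mat n q A = A * (eval_mat n p A * eval_mat n q A)"
    by (rule assoc_mult_mat[of _ n n _ n _ n]) auto
  also have "\<dots> = (0 \<cdot>\<^sub>m 1\<^sub>m n) + A * eval_mat n (p * q) A"
    by (auto simp: pCons.IH intro!: eq_matI)
  finally show ?case
    by (simp add: eval_mat_pCons eval_mat_add eval_mat_smult)
qed

lemma eval_mat_1 [simp]: "eval_mat n 1 A = 1\<^sub>m n"
proof -
  have "eval_mat n (pCons 1 0) A = 1\<^sub>m n"
    unfolding eval_mat_pCons by (auto intro!: eq_matI)
  then show ?thesis by (simp add: one_pCons)
qed

lemma eval_mat_linear: "eval_mat n [:a, 1:] A = a \<cdot>\<^sub>m 1\<^sub>m n + A"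
proof -
  have "1 \<cdot>\<^sub>m 1\<^sub>m n + A * 0\<^sub>m n n = 1\<^sub>m n" by (auto intro!: eq_matI)
  then show ?thesis by (simp add: eval_mat_pCons right_mult_one_mat[of _ n n])
qed

lemma eval_mat_power: "eval_mat n (p ^ k) A = eval_mat n p A ^\<^sub>m k"
  by (induction k) (simp_all add: eval_mat_mult mult.commute[of p])

end

section \<open>Nilpotency of strictly upper triangular matrices\<close>

lemma mult_mat_strip_zero:
  fixes A B :: "'a::comm_ring_1 mat"
  assumes "A \<in> carrier_mat n n" "B \<in> carrier_mat n n"
    and "\<And>i j. i < n \<Longrightarrow> j < n \<Longrightarrow> j < i + a \<Longrightarrow> A $$ (i,j) = 0"
    and "\<And>i j. i < n \<Longrightarrow> j < n \<Longrightarrow> j < i + b \<Longrightarrow> B $$ (i,j) = 0"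
    and "i < n" "j < n" "j < i + a + b"
  shows "(A * B) $$ (i,j) = 0"
proof -
  have "A $$ (i,l) * B $$ (l,j) = 0" if "l < n" for l
    using assms that by (cases "l < i + a") auto
  then show ?thesis using assms by (auto simp: scalar_prod_def)
qed

text \<open>Each factor widens the strip of zeros by one superdiagonal; after \<open>n\<close>
  factors it fills the matrix.\<close>

lemma strictly_upper_triangular_nilpotent:
  fixes N :: "'a::comm_ring_1 mat"
  assumes N: "N \<in> carrier_mat n n"
    and strict: "\<And>i j. i < n \<Longrightarrow> j < n \<Longrightarrow> j < i + 1 \<Longrightarrow> N $$ (i,j) = 0"
  shows "N ^\<^sub>m n = 0\<^sub>m n n"
proof -
  have "(N ^\<^sub>m m) $$ (i,j) = 0" if "i < n" "j < n" "j < i + m" for m i j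
    using that
  proof (induction m arbitrary: i j)
    case 0
    then show ?case using N by simp
  next
    case (Suc m)
    show ?case unfolding pow_mat.simps
      by (rule mult_mat_strip_zero[OF _ N Suc.IH strict, where b = 1]) (use N Suc.prems in auto)
  qed
  then show ?thesis using N by (intro eq_matI) auto
qed

section \<open>Newton iteration for k-th roots\<close>

lemma power2_dvd_one_minus_power:
  fixes y :: "'a::comm_ring_1"
  shows "y ^ 2 dvd (1 - y) ^ k - (1 - of_nat k * y)"
proof (induction k)
  case (Suc k)
  have "(1 - y) ^ Suc k - (1 - of_nat (Suc k) * y) =
        (1 - y) * ((1 - y) ^ k - (1 - of_nat k * y)) + y ^ 2 * of_nat k"
    by (simp add: algebra_simps power2_eq_square)
  then show ?case using Suc by (metis dvd_add dvd_mult dvd_triv_left)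
qed simp

text \<open>Newton's correction is f (1 - d / (k x)) with d = f^k - x, where \<open>u\<close>
  replaces 1 / (k x) and need be an inverse modulo \<open>P\<close> only. The linear error
  \<open>d * (1 - of_nat k * u * x)\<close> gains one factor \<open>P\<close>; the quadratic one is
  divisible by the power 2m of \<open>P\<close>, which is enough as
  \<open>m \<ge> 1\<close>.\<close>

lemma newton_step_kth_root:
  fixes f P u x :: "'a::comm_ring_1"
  assumes m: "m \<ge> 1" and f: "P ^ m dvd f ^ k - x" and u: "P dvd 1 - of_nat k * u * x"
  obtains f' where "P ^ Suc m dvd f' ^ k - x"
proof -
  define d where "d = f ^ k - x"
  obtain w where w: "(1 - d * u) ^ k - (1 - of_nat k * (d * u)) = (d * u) ^ 2 * w"
    using power2_dvd_one_minus_power[of "d * u" k] unfolding dvd_def by blast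
  have "(f * (1 - d * u)) ^ k - x = (x + d) * (1 - of_nat k * (d * u) + (d * u) ^ 2 * w) - x"
  proof -
    have "(1 - d * u) ^ k = 1 - of_nat k * (d * u) + (d * u) ^ 2 * w"
      using w by (metis add.commute diff_add_cancel)
    moreover have "f ^ k = x + d" by (simp add: d_def)
    ultimately show ?thesis by (simp add: power_mult_distrib)
  qed
  also have "\<dots> = d * (1 - of_nat k * u * x) + d ^ 2 * ((x + d) * u ^ 2 * w - of_nat k * u)"
    by (simp add: algebra_simps power2_eq_square)
  finally have eq: "(f * (1 - d * u)) ^ k - x = \<dots>" .
  have "P ^ Suc m dvd d * (1 - of_nat k * u * x)"
    using mult_dvd_mono[OF f u] by (simp add: d_def mult.commute)
  moreover have "P ^ Suc m dvd d ^ 2"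
  proof -
    have "P ^ Suc m dvd (P ^ m) ^ 2"
      unfolding power_mult[symmetric] by (rule le_imp_power_dvd) (use m in simp)
    also have "\<dots> dvd d ^ 2" using f by (simp add: d_def dvd_power_same)
    finally show ?thesis .
  qed
  ultimately have "P ^ Suc m dvd (f * (1 - d * u)) ^ k - x"
    unfolding eq by (intro dvd_add) (auto intro: dvd_mult2)
  then show ?thesis by (rule that)
qed

lemma kth_root_of_X_modulo:
  fixes g :: "'a::field" and k m :: nat
  defines "h \<equiv> g ^ k"
  defines "P \<equiv> [:-1, 1:] * [:-h, 1:]"
  assumes k: "(of_nat k :: 'a) \<noteq> 0" and h: "h \<noteq> 0" "h \<noteq> 1"
  shows "\<exists>f. P ^ m dvd f ^ k - [:0, 1:]"
proof (cases "m = 0")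
  case True
  then show ?thesis by simp
next
  case False
  \<comment> \<open>Since \<open>P\<close> is X^2 - (1 + h) X + h, the product X (1 + h - X) equals
    h modulo \<open>P\<close>; this yields the inverse of k X.\<close>
  define u where "u = smult (1 / (of_nat k * h)) [:1 + h, -1:]"
  have "1 - of_nat k * u * [:0, 1:] = smult (1 / h) P"
    using k h by (simp add: u_def P_def of_nat_poly field_simps one_pCons)
  then have u: "P dvd 1 - of_nat k * u * [:0, 1:]" by (simp add: dvd_smult)
  have "\<exists>f. P ^ Suc m dvd f ^ k - [:0, 1:]" for m
  proof (induction m)
    case 0
    \<comment> \<open>Linear interpolation through k-th roots of the two points: value
      \<open>1\<close> at \<open>1\<close> and \<open>g\<close> at \<open>h\<close>.\<close>
    define f where "f = 1 + smult ((g - 1) / (h - 1)) [:-1, 1:]"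
    have f: "poly f 1 = 1" "poly f h = g" using h by (simp_all add: f_def divide_simps) (simp add: algebra_simps)
    have "poly (f ^ k - [:0, 1:]) 1 = 0" using f by simp
    then obtain q where q: "f ^ k - [:0, 1:] = [:-1, 1:] * q"
      unfolding poly_eq_0_iff_dvd dvd_def by blast
    have "poly ([:-1, 1:] * q) h = 0"
      unfolding q[symmetric] using f by (simp add: h_def)
    then have "poly q h = 0" using h by simp
    then have "[:-h, 1:] dvd q" by (simp add: poly_eq_0_iff_dvd)
    then have "P dvd f ^ k - [:0, 1:]" unfolding q P_def by (rule mult_dvd_mono[OF dvd_refl])
    then show ?case by auto
  next
    case (Suc m)
    then obtain f where "P ^ Suc m dvd f ^ k - [:0, 1:]" by blast
    from newton_step_kth_root[OF _ this u] show ?case by auto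
  qed
  from this[of "m - 1"] False show ?thesis by simp
qed

text \<open>The product (T - 1) (T - h) has zero diagonal, so its \<open>n\<close>-th power
  vanishes, and a k-th root of X modulo that power of \<open>P\<close> evaluates at \<open>T\<close>
  to a root of \<open>T\<close>.\<close>

lemma upper_triangular_kth_root:
  fixes g :: "'a::field" and T :: "'a mat"
  assumes T: "T \<in> carrier_mat n n" "upper_triangular T"
    and diag: "\<And>i. i < n \<Longrightarrow> T $$ (i,i) \<in> {1, g ^ k}"
    and k: "(of_nat k :: 'a) \<noteq> 0" and g: "g ^ k \<noteq> 0" "g ^ k \<noteq> 1"
  obtains S where "S \<in> carrier_mat n n" "S ^\<^sub>m k = T"
proof -
  define h where "h = g ^ k"
  define P where "P = [:-1, 1:] * [:-h, 1:]"
  obtain f q where fq: "f ^ k - [:0, 1:] = P ^ n * q"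
    using kth_root_of_X_modulo[OF k g] unfolding P_def h_def dvd_def by blast
  define T1 where "T1 = eval_mat n [:-1, 1:] T"
  define T2 where "T2 = eval_mat n [:-h, 1:] T"
  have T1: "T1 \<in> carrier_mat n n" "\<And>i j. i < n \<Longrightarrow> j < n \<Longrightarrow> T1 $$ (i,j) = T $$ (i,j) - (if i = j then 1 else 0)"
    using T(1) by (auto simp: T1_def eval_mat_linear)
  have T2: "T2 \<in> carrier_mat n n" "\<And>i j. i < n \<Longrightarrow> j < n \<Longrightarrow> T2 $$ (i,j) = T $$ (i,j) - (if i = j then h else 0)"
    using T(1) by (auto simp: T2_def eval_mat_linear)
  have z: "T $$ (i,j) = 0" if "i < n" "j < i" for i j using T that by auto
  have "(T1 * T2) $$ (i,j) = 0" if ij: "i < n" "j < n" "j < i + 1" for i j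
  proof -
    have "T1 $$ (i,l) * T2 $$ (l,j) = 0" if "l < n" for l
      using T1(2)[of i l] T2(2)[of l j] ij that z[of i l] z[of l j] diag[of i]
      by (cases l i rule: linorder_cases; cases j i rule: linorder_cases) (auto simp: h_def)
    then have "(\<Sum>l = 0..<n. T1 $$ (i,l) * T2 $$ (l,j)) = 0" by (intro sum.neutral) auto
    then show ?thesis using ij T1(1) T2(1) by (auto simp: scalar_prod_def)
  qed
  then have "(T1 * T2) ^\<^sub>m n = 0\<^sub>m n n"
    using T1(1) T2(1) by (intro strictly_upper_triangular_nilpotent) auto
  moreover have "eval_mat n P T = T1 * T2"
    unfolding P_def T1_def T2_def by (rule eval_mat_mult[OF T(1)])
  ultimately have "eval_mat n (P ^ n) T = 0\<^sub>m n n"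
    using T(1) by (simp add: eval_mat_power)
  then have "eval_mat n (P ^ n * q) T = 0\<^sub>m n n"
    using T(1) by (simp add: eval_mat_mult left_mult_zero_mat[of _ _ n])
  moreover have "f ^ k = P ^ n * q + [:0, 1:]" using fq by (simp add: algebra_simps)
  ultimately have "eval_mat n (f ^ k) T = eval_mat n [:0, 1:] T"
    using T(1) by (simp add: eval_mat_add)
  also have "\<dots> = T" using T(1) by (auto simp: eval_mat_linear intro!: eq_matI)
  finally show ?thesis
    using T(1) by (intro that[of "eval_mat n f T"]) (simp_all add: eval_mat_power)
qed

lemma transpose_pow_mat:
  fixes A :: "'a::comm_ring_1 mat"
  assumes A: "A \<in> carrier_mat n n"
  shows "transpose_mat (A ^\<^sub>m k) = transpose_mat A ^\<^sub>m k"
proof -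
  have comm: "A ^\<^sub>m k * A = A * A ^\<^sub>m k" for k
  proof (induction k)
    case 0
    then show ?case using A by simp
  next
    case (Suc k)
    then show ?case using A assoc_mult_mat[OF A pow_carrier_mat[OF A] A, of k] by simp
  qed
  show ?thesis
  proof (induction k)
    case 0
    then show ?case using A by simp
  next
    case (Suc k)
    have "transpose_mat (A * A ^\<^sub>m k) = transpose_mat (A ^\<^sub>m k) * transpose_mat A"
      using A by (intro transpose_mult[of _ n n _ n]) auto
    then show ?case using Suc comm[of k] by simp
  qed
qed

section \<open>Nonscalar matrices as sums of two invertible k-th powers\<close>

lemma invertible_matI:
  assumes "A \<in> carrier_mat n n" "B \<in> carrier_mat n n" "A * B = 1\<^sub>m n" "B * A = 1\<^sub>m n"
  shows "invertible_mat A"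
  unfolding invertible_mat_def inverts_mat_def
  using assms by (intro conjI exI[of _ B]) auto

lemma det_nonzero_imp_invertible_mat:
  fixes A :: "'a::field mat"
  assumes A: "A \<in> carrier_mat n n" and "det A \<noteq> 0"
  shows "invertible_mat A"
proof -
  from det_non_zero_imp_unit[OF assms, of "()"]
  obtain B where "B \<in> carrier_mat n n" "B * A = 1\<^sub>m n" "A * B = 1\<^sub>m n"
    unfolding Units_def ring_mat_def by auto
  with A show ?thesis by (intro invertible_matI[of _ n B])
qed

lemma nonscalar_sum_of_kth_powers:
  fixes M :: "'a::field mat" and g :: 'a
  assumes M: "M \<in> carrier_mat n n" and ns: "\<And>c. M \<noteq> c \<cdot>\<^sub>m 1\<^sub>m n" and two: "(2::'a) \<noteq> 0"
    and k: "(of_nat k :: 'a) \<noteq> 0" and g: "g ^ k \<noteq> 0" "g ^ k \<noteq> 1"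
    and j: "j \<le> 2 * n" "(\<Sum>i<n. M $$ (i,i)) = of_nat (2 * n) + of_nat j * (g ^ k - 1)"
  obtains A B where "A \<in> carrier_mat n n" "B \<in> carrier_mat n n" "invertible_mat A" "invertible_mat B"
    "M = A ^\<^sub>m k + B ^\<^sub>m k"
proof -
  define h where "h = g ^ k"
  \<comment> \<open>Of the \<open>2 * n\<close> diagonal places of the two summands the first
    \<open>j\<close> carry \<open>h\<close>, the others \<open>1\<close>; each \<open>h\<close>
    raises the trace by \<open>h - 1\<close>.\<close>
  define a where "a = (\<lambda>i. if i < j then h else 1)"
  define b where "b = (\<lambda>i. if n + i < j then h else 1)"
  have cnt: "(\<Sum>i<n. if i < j then h else 1) = of_nat n + of_nat (min j n) * (h - 1)" for n j
  proof (induction n)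
    case (Suc n)
    then show ?case
      by (cases "n < j") (simp_all add: algebra_simps min_absorb1 min_absorb2 Suc_leI)
  qed simp
  have b: "b = (\<lambda>i. if i < j - n then h else 1)" by (auto simp: b_def fun_eq_iff)
  have "min j n + min (j - n) n = j" using j(1) by (auto simp: min_def)
  then have "of_nat j = of_nat (min j n) + (of_nat (min (j - n) n) :: 'a)"
    by (metis of_nat_add)
  then have tr: "(\<Sum>i<n. a i + b i) = (\<Sum>i<n. M $$ (i,i))"
    unfolding sum.distrib unfolding a_def b cnt j(2) h_def[symmetric]
    by (simp add: algebra_simps)
  obtain D where D: "D \<in> carrier_mat n n" "similar_mat D M"
    and diag: "\<forall>i<n. D $$ (i,i) = a i + b i"
    using nonscalar_similar_prescribed_diagonal[OF M ns two tr] .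
  define U where "U = mat n n (\<lambda>(i,l). if i = l then a i else if i < l then D $$ (i,l) else 0)"
  \<comment> \<open>\<open>L\<close> stores the part below the diagonal transposed, so the root
    lemma for upper triangular matrices serves both summands.\<close>
  define L where "L = mat n n (\<lambda>(i,l). if i = l then b i else if i < l then D $$ (l,i) else 0)"
  have UL: "U \<in> carrier_mat n n" "L \<in> carrier_mat n n" "upper_triangular U" "upper_triangular L"
    by (auto simp: U_def L_def)
  have DUL: "D = U + transpose_mat L"
    using D diag by (intro eq_matI) (auto simp: U_def L_def)
  have root: "\<exists>S. S \<in> carrier_mat n n \<and> S ^\<^sub>m k = T \<and> det S \<noteq> 0"
    if T: "T \<in> carrier_mat n n" "upper_triangular T" "\<And>i. i < n \<Longrightarrow> T $$ (i,i) \<in> {1, h}" for T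
  proof -
    obtain S where S: "S \<in> carrier_mat n n" "S ^\<^sub>m k = T"
      using upper_triangular_kth_root[OF T(1,2) T(3)[unfolded h_def] k g] .
    have "det T = prod_list (diag_mat T)" using T det_upper_triangular by blast
    moreover have "0 \<notin> set (diag_mat T)"
      using T(1,3) g by (force simp: diag_mat_def h_def)
    ultimately have "det T \<noteq> 0" by simp
    moreover have "det (S ^\<^sub>m k) = det S ^ k"
      using S(1) by (induction k) (auto simp: det_mult[of _ n] mult.commute)
    moreover have "k \<noteq> 0" using k by (metis of_nat_0)
    ultimately show ?thesis using S by (auto simp: power_0_left)
  qed
  have "\<And>i. i < n \<Longrightarrow> U $$ (i,i) \<in> {1, h}" "\<And>i. i < n \<Longrightarrow> L $$ (i,i) \<in> {1, h}"
    by (auto simp: U_def a_def L_def b_def)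
  note roots = root[OF UL(1,3) this(1)] root[OF UL(2,4) this(2)]
  obtain A where A: "A \<in> carrier_mat n n" "A ^\<^sub>m k = U" "det A \<noteq> 0"
    using roots(1) by blast
  obtain B where B: "B \<in> carrier_mat n n" "B ^\<^sub>m k = L" "det B \<noteq> 0"
    using roots(2) by blast
  define B' where "B' = transpose_mat B"
  have B': "B' \<in> carrier_mat n n" "B' ^\<^sub>m k = transpose_mat L" "det B' \<noteq> 0"
    using B transpose_pow_mat[OF B(1), of k] det_transpose[OF B(1)] by (simp_all add: B'_def)
  obtain m P Q where m: "{M, D, P, Q} \<subseteq> carrier_mat m m" "P * Q = 1\<^sub>m m" "Q * P = 1\<^sub>m m"
    and MD: "M = P * D * Q"
    using similar_matD[OF similar_mat_sym[OF D(2)]] by blast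
  have "m = n" using m(1) M unfolding carrier_mat_def by simp
  then have PQ: "P \<in> carrier_mat n n" "Q \<in> carrier_mat n n" "P * Q = 1\<^sub>m n" "Q * P = 1\<^sub>m n"
    using m by auto
  have conj: "P * Y * Q \<in> carrier_mat n n \<and> invertible_mat (P * Y * Q) \<and> (P * Y * Q) ^\<^sub>m k = P * Y ^\<^sub>m k * Q"
    if Y: "Y \<in> carrier_mat n n" "det Y \<noteq> 0" for Y
  proof -
    have c: "P * Y * Q \<in> carrier_mat n n" using Y PQ by auto
    have "det P * det Q = 1" using det_mult[OF PQ(1,2)] PQ(3) by simp
    then have "det P \<noteq> 0" "det Q \<noteq> 0" by auto
    then have "det (P * Y * Q) \<noteq> 0"
      using Y PQ by (simp add: det_mult[of _ n])
    then have "invertible_mat (P * Y * Q)" by (rule det_nonzero_imp_invertible_mat[OF c])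
    moreover have "similar_mat_wit (P * Y * Q) Y P Q"
      unfolding similar_mat_wit_def Let_def using Y PQ c by auto
    ultimately show ?thesis using similar_mat_wit_pow_id c by blast
  qed
  have "M = P * U * Q + P * transpose_mat L * Q"
    unfolding MD DUL using UL PQ
    by (simp add: mult_add_distrib_mat[of _ n n _ n] add_mult_distrib_mat[of _ n n _ _ n])
  then show ?thesis
    using conj[OF A(1,3)] conj[OF B'(1,3)] A(2) B'(2) by (intro that[of "P * A * Q" "P * B' * Q"]) auto
qed

section \<open>Sums of two powers in a finite field\<close>

text \<open>A subset of a field type, because the degree \<open>n\<close> of the field is a variable
  of the theorem: the field with p^n elements will be cut out of one algebraic closure.\<close>

locale finite_subfield =
  fixes K :: "'a::field set"
  assumes finite_K: "finite K"
    and zero_K: "0 \<in> K" and one_K: "1 \<in> K"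
    and add_K: "x \<in> K \<Longrightarrow> y \<in> K \<Longrightarrow> x + y \<in> K"
    and mult_K: "x \<in> K \<Longrightarrow> y \<in> K \<Longrightarrow> x * y \<in> K"
    and uminus_K: "x \<in> K \<Longrightarrow> - x \<in> K"
    and inverse_K: "x \<in> K \<Longrightarrow> inverse x \<in> K"
begin

lemmas closed_K [intro, simp] = finite_K zero_K one_K add_K mult_K uminus_K inverse_K

lemma diff_K [intro, simp]: "x \<in> K \<Longrightarrow> y \<in> K \<Longrightarrow> x - y \<in> K"
  using add_K[of x "- y"] by simp

lemma divide_K [intro, simp]: "x \<in> K \<Longrightarrow> y \<in> K \<Longrightarrow> x / y \<in> K"
  by (simp add: divide_inverse)

lemma power_K [intro, simp]: "x \<in> K \<Longrightarrow> x ^ m \<in> K"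
  by (induction m) auto

definition q :: nat where "q = card K"

definition K' :: "'a set" where "K' = K - {0}"

lemma finite_K' [intro, simp]: "finite K'"
  by (simp add: K'_def)

lemma in_K' [simp]: "x \<in> K' \<longleftrightarrow> x \<in> K \<and> x \<noteq> 0"
  by (simp add: K'_def)

lemma q_pos: "q > 0" and q_gt_1: "q > 1" and card_K': "card K' = q - 1"
proof -
  have "card {0, 1::'a} \<le> card K" by (rule card_mono) auto
  then show "q > 0" "q > 1" by (auto simp: q_def)
  show "card K' = q - 1" by (simp add: K'_def q_def)
qed

lemma real_q_minus_1: "real (q - 1) = real q - 1"
  using q_pos by (simp add: of_nat_diff)

lemma sum_K_split: "(\<Sum>a\<in>K. f a) = f 0 + (\<Sum>a\<in>K'. f a)" for f :: "'a \<Rightarrow> 'b::comm_monoid_add"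
  unfolding K'_def by (rule sum.remove) auto

lemma sum_K_mult: "z \<in> K' \<Longrightarrow> (\<Sum>a\<in>K. f (z * a)) = (\<Sum>a\<in>K. f a)"
  by (rule sum.reindex_bij_witness[of _ "\<lambda>a. a / z" "\<lambda>a. z * a"]) auto

lemma sum_K'_mult: "z \<in> K' \<Longrightarrow> (\<Sum>a\<in>K'. f (z * a)) = (\<Sum>a\<in>K'. f a)"
  by (rule sum.reindex_bij_witness[of _ "\<lambda>a. a / z" "\<lambda>a. z * a"]) auto

end

locale finite_subfield_power = finite_subfield +
  fixes k :: nat
  assumes k_pos: "k > 0"
begin

definition roots_of_unity where "roots_of_unity = {z \<in> K. z ^ k = 1}"

definition D :: nat where "D = card roots_of_unity"

text \<open>The number of cosets of \<open>H\<close> in \<open>K'\<close> besides \<open>H\<close>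
  itself, and the factor in the classical bound (D - 1) sqrt q for the sums
  \<open>T\<close>.\<close>

definition E :: real where "E = real D - 1"

definition H where "H = (\<lambda>z. z ^ k) ` K'"

lemma H_in_K': "H \<subseteq> K'"
  by (auto simp: H_def)

lemma finite_H [simp]: "finite H"
  by (simp add: H_def)

lemma D_pos: "D > 0"
proof -
  have "1 \<in> roots_of_unity" by (simp add: roots_of_unity_def)
  moreover have "finite roots_of_unity" by (simp add: roots_of_unity_def)
  ultimately show ?thesis unfolding D_def card_gt_0_iff by blast
qed

lemma E_nonneg: "E \<ge> 0"
  using D_pos by (simp add: E_def)

lemma card_H: "card H * D = q - 1"
proof -
  have fib: "card {z \<in> K'. z ^ k = y} = D" if "y \<in> H" for y
  proof -
    from that obtain w where w: "w \<in> K" "w \<noteq> 0" "y = w ^ k" by (auto simp: H_def)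
    have nz: "z \<noteq> 0" if "z ^ k = 1" for z :: 'a using that k_pos by (auto simp: power_0_left)
    have "bij_betw (\<lambda>z. z * w) roots_of_unity {z \<in> K'. z ^ k = y}"
      by (rule bij_betw_byWitness[of _ "\<lambda>z. z / w"])
        (use w nz in \<open>auto simp: roots_of_unity_def power_mult_distrib power_divide\<close>)
    then show ?thesis unfolding D_def by (rule bij_betw_same_card[symmetric])
  qed
  have "(\<Sum>y\<in>H. \<Sum>z\<in>{z \<in> K'. z ^ k = y}. (1::nat)) = (\<Sum>z\<in>K'. 1)"
    by (rule sum.group) (auto simp: H_def)
  then show ?thesis using fib by (simp add: card_K')
qed

text \<open>For \<open>y \<noteq> 0\<close> the quotient x / y is a root of unity. This count
  becomes the second moment of \<open>T\<close>.\<close>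

lemma card_equal_powers: "card {(x,y) \<in> K \<times> K. x ^ k = y ^ k} = 1 + (q - 1) * D"
proof -
  have eq: "{(x,y) \<in> K \<times> K. x ^ k = y ^ k} = insert (0,0) ((\<lambda>(z,y). (z * y, y)) ` (roots_of_unity \<times> K'))"
    (is "?L = ?R")
  proof (intro equalityI subsetI)
    fix v assume "v \<in> ?L"
    then obtain x y where v: "v = (x,y)" "x \<in> K" "y \<in> K" "x ^ k = y ^ k" by auto
    show "v \<in> ?R"
    proof (cases "y = 0")
      case True
      with v k_pos show ?thesis by (simp add: power_0_left)
    next
      case False
      with v have "(x,y) = (\<lambda>(z,y). (z * y, y)) (x / y, y)" "x / y \<in> roots_of_unity" "y \<in> K'"
        by (auto simp: roots_of_unity_def power_divide)
      then show ?thesis unfolding v(1) by blast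
    qed
  qed (auto simp: roots_of_unity_def power_mult_distrib)
  have "inj_on (\<lambda>(z,y). (z * y, y)) (roots_of_unity \<times> K')"
    by (auto simp: inj_on_def)
  then have "card ((\<lambda>(z,y). (z * y, y)) ` (roots_of_unity \<times> K')) = D * (q - 1)"
    by (simp add: card_image card_cartesian_product D_def card_K')
  moreover have "(0,0) \<notin> (\<lambda>(z,y). (z * y, y)) ` (roots_of_unity \<times> K')" by auto
  moreover have "finite (roots_of_unity \<times> K')" by (simp add: roots_of_unity_def)
  ultimately show ?thesis unfolding eq by simp
qed

text \<open>A solution with \<open>y \<noteq> 0\<close> would make \<open>-1\<close> the k-th power
  of x / y. The count determines the sum of the squares of \<open>T\<close> exactly.\<close>

lemma card_opposite_powers:
  assumes "-1 \<notin> H"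
  shows "card {(x,y) \<in> K \<times> K. x ^ k + y ^ k = 0} = 1"
proof -
  have "x = 0 \<and> y = 0" if "x \<in> K" "y \<in> K" "x ^ k + y ^ k = 0" for x y
  proof (cases "y = 0")
    case True
    with that k_pos show ?thesis by (simp add: power_0_left)
  next
    case False
    with that have "(x / y) ^ k = -1"
      by (simp add: power_divide divide_simps eq_neg_iff_add_eq_0)
    moreover from this k_pos have "x / y \<noteq> 0" by (auto simp: power_0_left)
    ultimately have "-1 \<in> H" using that unfolding H_def
      by (intro image_eqI[of _ _ "x / y"]) auto
    with assms show ?thesis by simp
  qed
  then have "{(x,y) \<in> K \<times> K. x ^ k + y ^ k = 0} = {(0,0)}"
    using k_pos by (auto simp: power_0_left)
  then show ?thesis by simp
qed

end

section \<open>Additive characters, the sums T and the number of solutions\<close>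

locale additive_character = finite_subfield_power +
  fixes \<psi> :: "'a \<Rightarrow> complex"
  assumes psi_add: "x \<in> K \<Longrightarrow> y \<in> K \<Longrightarrow> \<psi> (x + y) = \<psi> x * \<psi> y"
    and norm_psi: "x \<in> K \<Longrightarrow> norm (\<psi> x) = 1"
    and psi_nontrivial: "\<exists>z\<in>K. \<psi> z \<noteq> 1"
begin

lemma psi_0 [simp]: "\<psi> 0 = 1"
  using psi_add[of 0 0] norm_psi[of 0] by auto

lemma psi_uminus: "x \<in> K \<Longrightarrow> \<psi> (- x) = cnj (\<psi> x)"
proof -
  assume x: "x \<in> K"
  have "\<psi> x * \<psi> (- x) = 1" using psi_add[of x "- x"] x by simp
  moreover have "\<psi> x * cnj (\<psi> x) = 1"
    using norm_psi[OF x] by (simp add: complex_norm_square[symmetric])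
  moreover have "\<psi> x \<noteq> 0" using norm_psi[OF x] by auto
  ultimately show ?thesis by (metis mult_cancel_left)
qed

lemma sum_psi: "(\<Sum>a\<in>K. \<psi> a) = 0"
proof -
  obtain z where z: "z \<in> K" "\<psi> z \<noteq> 1" using psi_nontrivial by blast
  have "(\<Sum>a\<in>K. \<psi> a) = (\<Sum>a\<in>K. \<psi> (z + a))"
    by (rule sum.reindex_bij_witness[of _ "\<lambda>a. z + a" "\<lambda>a. a - z"]) (use z in auto)
  also have "\<dots> = \<psi> z * (\<Sum>a\<in>K. \<psi> a)"
    unfolding sum_distrib_left by (rule sum.cong) (use z psi_add in auto)
  finally show ?thesis using z by simp
qed

lemma sum_psi_mult: "b \<in> K \<Longrightarrow> (\<Sum>a\<in>K. \<psi> (a * b)) = (if b = 0 then of_nat q else 0)"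
  using sum_K_mult[of b \<psi>] sum_psi by (simp add: mult.commute q_def)

text \<open>Orthogonality of characters as a counting device: it turns every moment of
  \<open>T\<close> into a number of solutions.\<close>

lemma count_zeros:
  assumes "finite Y" "\<And>x. x \<in> Y \<Longrightarrow> u x \<in> K"
  shows "(\<Sum>a\<in>K. \<Sum>x\<in>Y. \<psi> (a * u x)) = of_nat (q * card {x \<in> Y. u x = 0})"
proof -
  have "(\<Sum>a\<in>K. \<Sum>x\<in>Y. \<psi> (a * u x)) = (\<Sum>x\<in>Y. \<Sum>a\<in>K. \<psi> (a * u x))"
    by (rule sum.swap)
  also have "\<dots> = (\<Sum>x\<in>Y. if u x = 0 then of_nat q else 0)"
    by (rule sum.cong) (use assms sum_psi_mult in auto)
  also have "\<dots> = of_nat (q * card {x \<in> Y. u x = 0})"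
    using assms(1) by (simp add: sum.If_cases Int_def mult.commute)
  finally show ?thesis .
qed

definition T :: "'a \<Rightarrow> complex" where "T a = (\<Sum>x\<in>K. \<psi> (a * x ^ k))"

lemma T_0: "T 0 = of_nat q"
  by (simp add: T_def q_def)

lemma T_mult_power: "a \<in> K \<Longrightarrow> z \<in> K' \<Longrightarrow> T (a * z ^ k) = T a"
  using sum_K_mult[of z "\<lambda>x. \<psi> (a * x ^ k)"]
  by (simp add: T_def power_mult_distrib mult.assoc)

lemma T_mult_H: "a \<in> K \<Longrightarrow> h \<in> H \<Longrightarrow> T (a * h) = T a"
  by (auto simp: H_def T_mult_power)

lemma T_uminus: "a \<in> K \<Longrightarrow> T (- a) = cnj (T a)"
  using psi_uminus by (simp add: T_def)

lemma sum_T: "(\<Sum>a\<in>K'. T a) = 0"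
proof -
  have "{x \<in> K. x ^ k = 0} = {0}" using k_pos by (auto simp: power_0_left)
  then have "(\<Sum>a\<in>K. T a) = of_nat q"
    unfolding T_def using count_zeros[of K "\<lambda>x. x ^ k"] by simp
  then show ?thesis unfolding sum_K_split T_0 by simp
qed

lemma T_mult_T_eq:
  assumes "a \<in> K" "c \<in> K"
  shows "T a * T a * \<psi> (- (a * c)) = (\<Sum>(x,y)\<in>K \<times> K. \<psi> (a * (x ^ k + y ^ k - c)))"
proof -
  have "T a * T a * \<psi> (- (a * c)) = (\<Sum>(x,y)\<in>K \<times> K. \<psi> (a * x ^ k) * \<psi> (a * y ^ k)) * \<psi> (- (a * c))"
    unfolding T_def by (simp add: sum_product sum.cartesian_product)
  also have "\<dots> = (\<Sum>(x,y)\<in>K \<times> K. \<psi> (a * (x ^ k + y ^ k - c)))"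
    unfolding sum_distrib_right
    by (rule sum.cong) (use assms in \<open>auto simp: psi_add[symmetric] algebra_simps\<close>)
  finally show ?thesis .
qed

definition N :: "'a \<Rightarrow> nat" where "N c = card {(x,y) \<in> K \<times> K. x ^ k + y ^ k = c}"

lemma sum_T_mult_T_psi:
  assumes "c \<in> K"
  shows "(\<Sum>a\<in>K'. T a * T a * \<psi> (- (a * c))) = of_nat (q * N c) - of_nat q ^ 2"
proof -
  have "(\<Sum>a\<in>K. T a * T a * \<psi> (- (a * c))) = (\<Sum>a\<in>K. \<Sum>(x,y)\<in>K \<times> K. \<psi> (a * (x ^ k + y ^ k - c)))"
    using assms T_mult_T_eq by (intro sum.cong) auto
  also have "\<dots> = (\<Sum>a\<in>K. \<Sum>v\<in>K \<times> K. \<psi> (a * (fst v ^ k + snd v ^ k - c)))"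
    by (simp add: case_prod_beta)
  also have "\<dots> = of_nat (q * card {v \<in> K \<times> K. fst v ^ k + snd v ^ k - c = 0})"
    by (rule count_zeros) (use assms in auto)
  also have "{v \<in> K \<times> K. fst v ^ k + snd v ^ k - c = 0} = {(x,y) \<in> K \<times> K. x ^ k + y ^ k = c}"
    by auto
  finally show ?thesis unfolding sum_K_split T_0 by (simp add: N_def power2_eq_square algebra_simps)
qed

lemma sum_T_mult_T: "(\<Sum>a\<in>K'. T a * T a) = of_nat (q * N 0) - of_nat q ^ 2"
  using sum_T_mult_T_psi[of 0] by simp

text \<open>Writing |T(a)|^2 as T(a) T(-a) counts pairs with equal powers; removing the term q^2 at
  a = 0 replaces the factor \<open>D\<close> by \<open>E\<close>.\<close>

lemma sum_norm_T: "(\<Sum>a\<in>K'. (norm (T a))\<^sup>2) = real q * (real q - 1) * E"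
proof -
  have "(\<Sum>a\<in>K. T a * cnj (T a)) = (\<Sum>a\<in>K. \<Sum>v\<in>K \<times> K. \<psi> (a * (fst v ^ k - snd v ^ k)))"
  proof (rule sum.cong)
    fix a assume a: "a \<in> K"
    have "T a * cnj (T a) = T a * T (- a)" using a by (simp add: T_uminus)
    also have "\<dots> = (\<Sum>(x,y)\<in>K \<times> K. \<psi> (a * x ^ k) * \<psi> (- a * y ^ k))"
      unfolding T_def by (simp add: sum_product sum.cartesian_product)
    also have "\<dots> = (\<Sum>v\<in>K \<times> K. \<psi> (a * (fst v ^ k - snd v ^ k)))"
      by (rule sum.cong) (use a in \<open>auto simp: psi_add[symmetric] algebra_simps\<close>)
    finally show "T a * cnj (T a) = (\<Sum>v\<in>K \<times> K. \<psi> (a * (fst v ^ k - snd v ^ k)))" .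
  qed simp
  also have "\<dots> = of_nat (q * card {v \<in> K \<times> K. fst v ^ k - snd v ^ k = 0})"
    by (rule count_zeros) auto
  also have "{v \<in> K \<times> K. fst v ^ k - snd v ^ k = 0} = {(x,y) \<in> K \<times> K. x ^ k = y ^ k}"
    by auto
  also have "card \<dots> = 1 + (q - 1) * D" by (rule card_equal_powers)
  finally have "complex_of_real (\<Sum>a\<in>K. (norm (T a))\<^sup>2) = of_real (real (q * (1 + (q - 1) * D)))"
    by (simp only: complex_norm_square of_real_sum of_real_of_nat_eq)
  then have "(\<Sum>a\<in>K. (norm (T a))\<^sup>2) = real (q * (1 + (q - 1) * D))"
    by (simp only: of_real_eq_iff)
  then have "(\<Sum>a\<in>K'. (norm (T a))\<^sup>2) = real (q * (1 + (q - 1) * D)) - (real q)\<^sup>2"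
    unfolding sum_K_split T_0 by (simp add: algebra_simps)
  also have "\<dots> = q * (real q - 1) * E"
    unfolding of_nat_mult of_nat_add of_nat_1 real_q_minus_1 E_def
    by (simp add: power2_eq_square algebra_simps)
  finally show ?thesis .
qed

text \<open>\<open>T\<close> is constant on the \<open>D\<close> cosets of \<open>H\<close> and has mean zero, so each of its values is
  controlled by the values on the other \<open>E\<close> cosets.\<close>

lemma norm_T_le:
  assumes b: "b \<in> K'"
  shows "(norm (T b))\<^sup>2 \<le> q * E\<^sup>2"
proof -
  define C where "C = (\<lambda>h. b * h) ` H"
  define t where "t = (norm (T b))\<^sup>2"
  define m where "m = real (card H)"
  have C: "C \<subseteq> K'" using H_in_K' b by (auto simp: C_def)
  then have finC: "finite C" using finite_subset by blast
  have "card C = card H" unfolding C_def using b by (intro card_image) (auto simp: inj_on_def)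
  then have cardC: "real (card C) = m" by (simp add: m_def)
  have TC: "T c = T b" if "c \<in> C" for c using that T_mult_H b by (auto simp: C_def)
  have mD: "m * D = real q - 1" using card_H q_pos unfolding m_def
    by (metis of_nat_1 of_nat_diff of_nat_mult Suc_leI One_nat_def)
  have "m > 0" using mD q_gt_1 D_pos by (cases "m = 0") (auto simp: m_def)
  have "(\<Sum>a\<in>K' - C. T a) = - of_real m * T b"
  proof -
    have "(\<Sum>a\<in>K'. T a) = (\<Sum>a\<in>K' - C. T a) + (\<Sum>a\<in>C. T a)"
      using C by (intro sum.subset_diff) auto
    moreover have "(\<Sum>a\<in>C. T a) = of_real m * T b" using TC cardC by (simp flip: cardC)
    ultimately show ?thesis using sum_T by (simp add: eq_neg_iff_add_eq_0)
  qed
  then have "m * norm (T b) \<le> (\<Sum>a\<in>K' - C. norm (T a))"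
    using norm_sum[of T "K' - C"] \<open>m > 0\<close> by (simp add: norm_mult)
  then have "(m * norm (T b))\<^sup>2 \<le> (\<Sum>a\<in>K' - C. norm (T a))\<^sup>2"
    using \<open>m > 0\<close> by (intro power_mono) auto
  also have "\<dots> \<le> (\<Sum>a\<in>K' - C. (norm (T a))\<^sup>2) * card (K' - C)"
    by (rule sum_squared_le_sum_of_squares)
  also have "real (card (K' - C)) = m * E"
  proof -
    have "card (K' - C) + card C = card K'"
      using C by (simp add: card_Diff_subset finC card_mono)
    then have "real (card (K' - C)) + m = real q - 1"
      using cardC card_K' q_pos by (metis of_nat_add of_nat_1 of_nat_diff Suc_leI One_nat_def)
    then show ?thesis using mD by (simp add: E_def algebra_simps)
  qed
  also have "(\<Sum>a\<in>K' - C. (norm (T a))\<^sup>2) = q * (m * D) * E - m * t"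
  proof -
    have "(\<Sum>a\<in>K'. (norm (T a))\<^sup>2) = (\<Sum>a\<in>K' - C. (norm (T a))\<^sup>2) + (\<Sum>a\<in>C. (norm (T a))\<^sup>2)"
      using C by (intro sum.subset_diff) auto
    moreover have "(\<Sum>a\<in>C. (norm (T a))\<^sup>2) = m * t" using TC cardC by (simp add: t_def)
    ultimately show ?thesis using sum_norm_T q_pos by (simp add: mD of_nat_diff)
  qed
  finally have "m\<^sup>2 * t \<le> m\<^sup>2 * ((q * D * E - t) * E)"
    by (simp add: t_def power_mult_distrib power2_eq_square algebra_simps)
  \<comment> \<open>The unknown \<open>t\<close> stands on both sides; collecting it with D = E + 1
    gives the classical bound.\<close>
  then have "t \<le> (q * D * E - t) * E" using \<open>m > 0\<close> by simp
  moreover have "real D = E + 1" by (simp add: E_def)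
  ultimately have "(E + 1) * t \<le> (E + 1) * (q * E\<^sup>2)"
    by (simp add: algebra_simps power2_eq_square)
  then show ?thesis using E_nonneg by (simp add: t_def)
qed

text \<open>Character counting gives q N(c) as q^2 plus the sum of T(a)^2 \<psi>(-ac) over a
  \<noteq> 0. Replacing \<open>a\<close> by \<open>a * z ^ k\<close> does not change T(a), so
  summing over all \<open>z\<close> in \<open>K'\<close> turns the character value into T(-ac) - 1
  and multiplies the left side by q - 1. The count then depends on \<open>T\<close> alone.\<close>

lemma N_eq:
  assumes c: "c \<in> K"
  shows "of_nat (q * (q - 1) * N c) =
    of_nat (q\<^sup>2 * (q - 1)) + (\<Sum>a\<in>K'. T a * T a * T (- (a * c))) - (\<Sum>a\<in>K'. T a * T a)"
proof -
  define S where "S = (\<Sum>a\<in>K'. T a * T a * \<psi> (- (a * c)))"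
  have "S = (\<Sum>a\<in>K'. T a * T a * \<psi> (- (a * c) * z ^ k))" if "z \<in> K'" for z
  proof -
    have "S = (\<Sum>a\<in>K'. T (z ^ k * a) * T (z ^ k * a) * \<psi> (- (z ^ k * a * c)))"
      unfolding S_def by (rule sum_K'_mult[symmetric]) (use that in auto)
    also have "\<dots> = (\<Sum>a\<in>K'. T a * T a * \<psi> (- (a * c) * z ^ k))"
      by (rule sum.cong) (use that T_mult_power in \<open>auto simp: mult_ac\<close>)
    finally show ?thesis .
  qed
  then have "(\<Sum>z\<in>K'. S) = (\<Sum>z\<in>K'. \<Sum>a\<in>K'. T a * T a * \<psi> (- (a * c) * z ^ k))"
    by (intro sum.cong) auto
  also have "\<dots> = (\<Sum>a\<in>K'. \<Sum>z\<in>K'. T a * T a * \<psi> (- (a * c) * z ^ k))"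
    by (rule sum.swap)
  also have "\<dots> = (\<Sum>a\<in>K'. T a * T a * (T (- (a * c)) - 1))"
  proof (rule sum.cong)
    fix a
    have "T (- (a * c)) = 1 + (\<Sum>z\<in>K'. \<psi> (- (a * c) * z ^ k))"
      unfolding T_def sum_K_split using k_pos by (simp add: power_0_left)
    then show "(\<Sum>z\<in>K'. T a * T a * \<psi> (- (a * c) * z ^ k)) = T a * T a * (T (- (a * c)) - 1)"
      by (simp add: sum_distrib_left)
  qed simp
  finally have eq: "of_nat (q - 1) * S = (\<Sum>a\<in>K'. T a * T a * T (- (a * c))) - (\<Sum>a\<in>K'. T a * T a)"
    by (simp add: card_K' right_diff_distrib sum_subtractf)
  have "of_nat (q * N c) = S + of_nat (q\<^sup>2)"
    unfolding S_def using sum_T_mult_T_psi[OF c] by simp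
  then have "of_nat (q * (q - 1) * N c) = of_nat (q - 1) * (S + of_nat (q\<^sup>2))"
    by (metis of_nat_mult mult.assoc mult.left_commute)
  then show ?thesis using eq by (simp only: distrib_left of_nat_mult) (simp only: ac_simps add_diff_eq)
qed

text \<open>Two factors of the cubic sum are absorbed by the second moment, the third is bounded
  pointwise. Here \<open>N 0 = 1\<close>, so the sum of the squares of \<open>T\<close> is -q (q -
  1), and subtracting it lifts the main term to q + 1.\<close>

lemma N_ge_if_minus_one_not_power:
  assumes c: "c \<in> K'" and odd: "-1 \<notin> H"
  shows "N c \<ge> q + 1 - E\<^sup>2 * sqrt q"
proof -
  define S where "S = (\<Sum>a\<in>K'. T a * T a * T (- (a * c)))"
  have le: "norm (T a) \<le> E * sqrt q" if "a \<in> K'" for a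
  proof (rule power2_le_imp_le)
    show "(norm (T a))\<^sup>2 \<le> (E * sqrt q)\<^sup>2"
      using norm_T_le[OF that] by (simp add: power_mult_distrib mult.commute)
  qed (use E_nonneg in simp)
  have "norm S \<le> (\<Sum>a\<in>K'. norm (T a * T a * T (- (a * c))))"
    unfolding S_def by (rule norm_sum)
  also have "\<dots> \<le> (\<Sum>a\<in>K'. (norm (T a))\<^sup>2 * (E * sqrt q))"
    by (rule sum_mono) (use le c in \<open>auto simp: norm_mult power2_eq_square intro!: mult_left_mono\<close>)
  also have "\<dots> = q * (q - 1) * (E\<^sup>2 * sqrt q)"
    unfolding sum_distrib_right[symmetric] sum_norm_T real_q_minus_1[symmetric]
    by (simp add: power2_eq_square)
  finally have S: "norm S \<le> q * (q - 1) * (E\<^sup>2 * sqrt q)" .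
  have "N 0 = 1" unfolding N_def using card_opposite_powers[OF odd] by simp
  then have "(\<Sum>a\<in>K'. T a * T a) = - of_nat (q * (q - 1))"
    unfolding sum_T_mult_T using q_pos by (simp add: of_nat_diff algebra_simps power2_eq_square)
  then have "of_nat (q * (q - 1) * N c) = of_nat (q\<^sup>2 * (q - 1)) + S + of_nat (q * (q - 1))"
    using N_eq[of c] c by (simp only: S_def[symmetric] in_K' diff_minus_eq_add)
  then have "S = of_nat (q * (q - 1) * N c) - of_nat (q\<^sup>2 * (q - 1)) - of_nat (q * (q - 1))"
    by (simp only: algebra_simps)
  also have "\<dots> = of_real (- (real (q * (q - 1)) * (q + 1 - real (N c))))"
    by (simp add: right_diff_distrib distrib_left power2_eq_square)
  finally have "norm S = \<bar>- (real (q * (q - 1)) * (q + 1 - real (N c)))\<bar>"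
    by (simp only: norm_of_real)
  then have "real (q * (q - 1)) * (q + 1 - real (N c)) \<le> norm S"
    by linarith
  with S have "real (q * (q - 1)) * (q + 1 - real (N c)) \<le> real (q * (q - 1)) * (E\<^sup>2 * sqrt q)"
    by simp
  moreover have "real (q * (q - 1)) > 0" using q_gt_1 by simp
  ultimately have "q + 1 - real (N c) \<le> E\<^sup>2 * sqrt q" by (metis mult_le_cancel_left_pos)
  then show ?thesis by simp
qed

text \<open>If \<open>-1\<close> is a \<open>k\<close>-th power then \<open>T\<close> is real; centering \<open>T\<^sup>2\<close> at its mean before applying the
  Cauchy--Schwarz inequality gains the \<open>1/2\<close> that absorbs the error term \<open>E\<close>.\<close>

lemma N_ge_if_minus_one_power:
  assumes c: "c \<in> K'" and even: "-1 \<in> H"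
  shows "N c \<ge> q - E * (E - 1 / 2) * sqrt q - E"
proof -
  define t where "t a = Re (T a)" for a
  have Tt: "T a = of_real (t a)" if "a \<in> K" for a
  proof -
    have "cnj (T a) = T a" using T_uminus[OF that] T_mult_H[OF that even] by simp
    then show ?thesis unfolding t_def by (metis Reals_cnj_iff of_real_Re)
  qed
  define S where "S = (\<Sum>a\<in>K'. (t a)\<^sup>2 * t (c * a))"
  define m where "m = real q * E"
  have "(norm (T a))\<^sup>2 = (t a)\<^sup>2" if "a \<in> K'" for a using Tt[of a] that by simp
  then have t2: "(\<Sum>a\<in>K'. (t a)\<^sup>2) = real (q - 1) * m"
    and t2_le: "\<And>a. a \<in> K' \<Longrightarrow> (t a)\<^sup>2 \<le> m * E"
    using sum_norm_T norm_T_le by (simp_all add: m_def power2_eq_square algebra_simps real_q_minus_1[simplified])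
  have "(\<Sum>a\<in>K'. T a) = of_real (\<Sum>a\<in>K'. t a)" using Tt by simp
  then have t1: "(\<Sum>a\<in>K'. t a) = 0" using sum_T by (metis of_real_eq_0_iff)
  \<comment> \<open>Centering costs nothing because the values \<open>t (c * a)\<close> sum to
    zero.\<close>
  have "S = (\<Sum>a\<in>K'. ((t a)\<^sup>2 - m) * t (c * a))"
  proof -
    have "(\<Sum>a\<in>K'. m * t (c * a)) = 0"
      using sum_K'_mult[OF c, of t] t1 by (simp flip: sum_distrib_left)
    then show ?thesis by (simp add: S_def left_diff_distrib sum_subtractf)
  qed
  then have "S\<^sup>2 \<le> (\<Sum>a\<in>K'. ((t a)\<^sup>2 - m)\<^sup>2) * (\<Sum>a\<in>K'. (t (c * a))\<^sup>2)"
    using Cauchy_Schwarz_ineq_sum[of "\<lambda>a. (t a)\<^sup>2 - m" "\<lambda>a. t (c * a)" K'] by simp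
  also have "(\<Sum>a\<in>K'. (t (c * a))\<^sup>2) = real (q - 1) * m"
    using sum_K'_mult[OF c, of "\<lambda>a. (t a)\<^sup>2"] t2 by simp
  also have "(\<Sum>a\<in>K'. ((t a)\<^sup>2 - m)\<^sup>2) \<le> real (q - 1) * m\<^sup>2 * (E - 1)"
  proof -
    have "(\<Sum>a\<in>K'. ((t a)\<^sup>2 - m)\<^sup>2) \<le> (\<Sum>a\<in>K'. (m * E - 2 * m) * (t a)\<^sup>2 + m\<^sup>2)"
    proof (rule sum_mono)
      fix a assume "a \<in> K'"
      then have "(t a)\<^sup>2 * (t a)\<^sup>2 \<le> (m * E) * (t a)\<^sup>2" using t2_le by (intro mult_right_mono) auto
      then show "((t a)\<^sup>2 - m)\<^sup>2 \<le> (m * E - 2 * m) * (t a)\<^sup>2 + m\<^sup>2"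
        by (simp add: power2_diff power2_eq_square algebra_simps)
    qed
    also have "\<dots> = (m * E - 2 * m) * (real (q - 1) * m) + real (q - 1) * m\<^sup>2"
      by (simp add: sum.distrib card_K' t2 flip: sum_distrib_left)
    also have "\<dots> = real (q - 1) * m\<^sup>2 * (E - 1)"
      by (simp add: algebra_simps power2_eq_square)
    finally show ?thesis .
  qed
  finally have S2: "S\<^sup>2 \<le> real (q - 1) * m\<^sup>2 * (E - 1) * (real (q - 1) * m)"
    using E_nonneg by (simp add: mult_right_mono m_def)
  also have "\<dots> = (real (q * (q - 1)))\<^sup>2 * q * E\<^sup>2 * (E * (E - 1))"
    unfolding of_nat_mult m_def power2_eq_square by (simp only: ac_simps)
  \<comment> \<open>E (E - 1) is enlarged by 1/4 to a perfect square, so that the root can be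
    taken.\<close>
  also have "\<dots> \<le> (real (q * (q - 1)))\<^sup>2 * q * E\<^sup>2 * (E - 1 / 2)\<^sup>2"
  proof (rule mult_left_mono)
    show "E * (E - 1) \<le> (E - 1 / 2)\<^sup>2" by (simp add: power2_eq_square algebra_simps)
  qed simp
  also have "\<dots> = (real (q * (q - 1)) * (E * (E - 1 / 2) * sqrt q))\<^sup>2"
    unfolding power_mult_distrib by (simp only: real_sqrt_pow2 of_nat_0_le_iff ac_simps)
  finally have "\<bar>S\<bar> \<le> \<bar>real (q * (q - 1)) * (E * (E - 1 / 2) * sqrt q)\<bar>"
    by (simp only: abs_le_square_iff)
  \<comment> \<open>As \<open>D\<close> is a positive integer, \<open>E\<close> is 0 or at least 1,
    never strictly between 0 and 1/2.\<close>
  moreover have "E * (E - 1 / 2) \<ge> 0"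
    using D_pos by (cases "D = 1") (auto simp: E_def)
  then have "real (q * (q - 1)) * (E * (E - 1 / 2) * sqrt q) \<ge> 0" by simp
  ultimately have S: "- S \<le> real (q * (q - 1)) * (E * (E - 1 / 2) * sqrt q)"
    by linarith
  have "(\<Sum>a\<in>K'. T a * T a * T (- (a * c))) = of_real S"
  proof -
    have "T (- (a * c)) = of_real (t (c * a))" if "a \<in> K'" for a
      using T_uminus[of "a * c"] Tt[of "a * c"] c that by (simp add: mult.commute)
    then show ?thesis using Tt by (simp add: S_def power2_eq_square)
  qed
  moreover have "(\<Sum>a\<in>K'. T a * T a) = of_real (real (q - 1) * m)"
  proof -
    have "(\<Sum>a\<in>K'. T a * T a) = of_real (\<Sum>a\<in>K'. (t a)\<^sup>2)"
      using Tt by (simp add: power2_eq_square)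
    then show ?thesis using t2 by simp
  qed
  ultimately have "complex_of_real (real (q * (q - 1) * N c)) =
      of_real (real (q\<^sup>2 * (q - 1)) + S - real (q - 1) * m)"
    using N_eq[of c] c by (simp only: of_real_add of_real_diff of_real_of_nat_eq in_K')
  then have "real (q * (q - 1) * N c) = real (q\<^sup>2 * (q - 1)) + S - real (q - 1) * m"
    by (simp only: of_real_eq_iff)
  moreover have "real (q * (q - 1) * N c) = real (q * (q - 1)) * N c"
    "real (q\<^sup>2 * (q - 1)) = real (q * (q - 1)) * q" "real (q - 1) * m = real (q * (q - 1)) * E"
    unfolding m_def of_nat_mult power2_eq_square by (simp_all only: ac_simps)
  ultimately have "real (q * (q - 1)) * (q - E - N c) = - S"
    unfolding right_diff_distrib by linarith
  with S have "real (q * (q - 1)) * (q - E - N c) \<le> real (q * (q - 1)) * (E * (E - 1 / 2) * sqrt q)"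
    by simp
  moreover have "real (q * (q - 1)) > 0" using q_gt_1 by simp
  ultimately have "q - E - N c \<le> E * (E - 1 / 2) * sqrt q" by (metis mult_le_cancel_left_pos)
  then show ?thesis by simp
qed

end

section \<open>Roots of unity and the group of k-th powers\<close>

lemma card_roots_of_one_le:
  fixes m :: nat
  assumes m: "m > 0"
  shows "finite {z::'a::field. z ^ m = 1}" "card {z::'a. z ^ m = 1} \<le> m"
proof -
  define f where "f = monom (1::'a) m - 1"
  have "coeff f m = 1" using m by (simp add: f_def coeff_1)
  then have f: "f \<noteq> 0" by auto
  have "degree f \<le> m" unfolding f_def by (rule degree_diff_le) (auto simp: degree_monom_eq)
  moreover have "{z. z ^ m = 1} = {z. poly f z = 0}" by (auto simp: f_def poly_monom)
  ultimately show "finite {z::'a. z ^ m = 1}" "card {z::'a. z ^ m = 1} \<le> m"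
    using poly_roots_finite[OF f] poly_roots_degree[OF f] by auto
qed

lemma (in finite_subfield) power_q_minus_1:
  assumes "z \<in> K'"
  shows "z ^ (q - 1) = 1"
proof -
  have "(\<Prod>a\<in>K'. a) = (\<Prod>a\<in>K'. z * a)"
    by (rule prod.reindex_bij_witness[of _ "\<lambda>a. z * a" "\<lambda>a. a / z"]) (use assms in auto)
  also have "\<dots> = z ^ (q - 1) * (\<Prod>a\<in>K'. a)"
    by (simp add: prod.distrib card_K')
  finally have "1 * (\<Prod>a\<in>K'. a) = z ^ (q - 1) * (\<Prod>a\<in>K'. a)" by simp
  moreover have "(\<Prod>a\<in>K'. a) \<noteq> 0" by simp
  ultimately show ?thesis by (metis mult_right_cancel)
qed

context finite_subfield_power
begin

text \<open>A k-th root of unity in \<open>K\<close> also satisfies z^(q - 1) = 1, so Bezout makes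
  it a root of unity for the gcd, and there are at most that many of those.\<close>

lemma D_le_gcd: "D \<le> gcd k (q - 1)"
proof -
  have "z ^ gcd k (q - 1) = 1" if "z \<in> roots_of_unity" for z
  proof -
    have z: "z \<in> K'" "z ^ k = 1" using that k_pos by (auto simp: roots_of_unity_def power_0_left)
    obtain x y where "k * x = (q - 1) * y + gcd k (q - 1)"
      using bezout_nat[of k "q - 1"] k_pos by auto
    moreover have "z ^ (k * x) = 1" "z ^ ((q - 1) * y) = 1"
      using z power_q_minus_1[OF z(1)] by (simp_all add: power_mult)
    ultimately show ?thesis by (simp add: power_add)
  qed
  then have "roots_of_unity \<subseteq> {z. z ^ gcd k (q - 1) = 1}" by auto
  moreover have "gcd k (q - 1) > 0" using k_pos by simp
  ultimately show ?thesis unfolding D_def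
    using card_roots_of_one_le[of "gcd k (q - 1)", where ?'a = 'a] by (meson card_mono order_trans)
qed

lemma E_le: "E \<le> real k - 1"
proof -
  have "D \<le> k" using D_le_gcd gcd_le1_nat[of k "q - 1"] k_pos by linarith
  then show ?thesis by (simp add: E_def)
qed

text \<open>With m = (q - 1) / gcd(k, q - 1), all elements of \<open>H\<close> are roots of X^m - 1,
  and \<open>card_H\<close> with \<open>D_le_gcd\<close> gives at least m of them. So
  \<open>H\<close> is the full root set, which contains -1 for even m.\<close>

lemma minus_one_in_H:
  assumes even: "even ((q - 1) div gcd k (q - 1))"
  shows "-1 \<in> H"
proof -
  define g where "g = gcd k (q - 1)"
  define m where "m = (q - 1) div g"
  have gm: "g * m = q - 1" by (simp add: g_def m_def)
  have g: "g > 0" using k_pos by (simp add: g_def)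
  have m: "m > 0" using gm q_gt_1 by (cases "m = 0") auto
  have "y ^ m = 1" if y: "y \<in> H" for y
  proof -
    obtain z where z: "z \<in> K'" "y = z ^ k" using y by (auto simp: H_def)
    have "k * m = (q - 1) * (k div g)" unfolding gm[symmetric] by (simp add: g_def)
    then have "y ^ m = (z ^ (q - 1)) ^ (k div g)" unfolding z(2) by (simp flip: power_mult)
    then show ?thesis using power_q_minus_1[OF z(1)] by simp
  qed
  then have sub: "H \<subseteq> {y. y ^ m = 1}" by auto
  have "m * g \<le> card H * g"
    using mult_le_mono2[OF D_le_gcd, of "card H"] unfolding card_H g_def[symmetric]
    by (simp only: gm[symmetric] mult.commute)
  then have "m \<le> card H" using g by simp
  then have "H = {y. y ^ m = 1}"
    using card_roots_of_one_le[OF m, where ?'a = 'a] sub by (intro card_subset_eq) (auto intro: antisym card_mono)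
  moreover have "(-1::'a) ^ m = 1" using even by (simp add: m_def g_def)
  ultimately show ?thesis by blast
qed

lemma card_power_eq_le: "card {y \<in> K. y ^ k = c} \<le> D" 
proof (cases "\<exists>w\<in>K. w ^ k = c")
  case False
  then have "{y \<in> K. y ^ k = c} = {}" by auto
  then show ?thesis by (simp only: card.empty)
next
  case True
  then obtain w where w: "w \<in> K" "w ^ k = c" by blast
  show ?thesis
  proof (cases "w = 0")
    case True
    then have "{y \<in> K. y ^ k = c} = {0}" using w k_pos by (auto simp: power_0_left)
    then show ?thesis using D_pos by simp
  next
    case False
    then have "inj_on (\<lambda>y. y / w) {y \<in> K. y ^ k = c}"
      "(\<lambda>y. y / w) ` {y \<in> K. y ^ k = c} \<subseteq> roots_of_unity"
      using w by (auto simp: inj_on_def roots_of_unity_def power_divide)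
    then show ?thesis unfolding D_def
      by (rule card_inj_on_le) (simp add: roots_of_unity_def)
  qed
qed

end

section \<open>Existence of solutions for large q\<close>

context additive_character
begin

text \<open>Both lower bounds for \<open>N c\<close> are positive: E^4 \<le> (k - 1)^4 < q gives E^2
  < sqrt q, and q \<ge> 4 lets the gain E sqrt q / 2 of the second bound cover its error
  \<open>E\<close>.\<close>

lemma exists_sum_of_powers:
  assumes c: "c \<in> K" and q4: "q \<ge> 4" and q: "real q > (real k - 1) ^ 4"
  shows "\<exists>x\<in>K. \<exists>y\<in>K. x ^ k + y ^ k = c"
proof (cases "c = 0")
  case True
  then show ?thesis using k_pos by (intro bexI[of _ 0]) (auto simp: power_0_left)
next
  case False
  with c have c': "c \<in> K'" by simp
  define s where "s = sqrt q"
  have s2: "real q = s * s" by (simp add: s_def)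
  have "2 \<le> s" unfolding s_def using q4 by (intro real_le_rsqrt) simp
  have "E ^ 4 \<le> (real k - 1) ^ 4" using E_nonneg E_le by (intro power_mono)
  then have "(E\<^sup>2)\<^sup>2 < q" using q by simp
  then have "E\<^sup>2 < s" unfolding s_def by (rule real_less_rsqrt)
  then have pos: "s * (s - E\<^sup>2) > 0" using \<open>2 \<le> s\<close> by simp
  have "real (N c) > 0"
  proof (cases "-1 \<in> H")
    case False
    have "q + 1 - E\<^sup>2 * s > 0" using pos by (simp add: s2 algebra_simps)
    then show ?thesis using N_ge_if_minus_one_not_power[OF c' False] by (simp add: s_def)
  next
    case True
    have "E * (s / 2 - 1) \<ge> 0" using \<open>2 \<le> s\<close> E_nonneg by simp
    moreover have "q - E * (E - 1 / 2) * s - E = s * (s - E\<^sup>2) + E * (s / 2 - 1)"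
      unfolding s2 by (simp add: algebra_simps power2_eq_square)
    ultimately have "q - E * (E - 1 / 2) * s - E > 0" using pos by linarith
    then show ?thesis using N_ge_if_minus_one_power[OF c' True] by (simp add: s_def)
  qed
  then have "{(x,y) \<in> K \<times> K. x ^ k + y ^ k = c} \<noteq> {}"
    unfolding N_def by (metis card.empty of_nat_0 less_irrefl)
  then show ?thesis by blast
qed

text \<open>For c \<noteq> 0 at most \<open>D\<close> solutions have x = 0 and at most
  \<open>D\<close> have y = 0, so it suffices that \<open>N c\<close> exceeds 2 D.\<close>

lemma exists_sum_of_unit_powers:
  assumes c: "c \<in> K" and even: "-1 \<in> H" and q: "real q > (real k - 1) ^ 4 + 4 * real k"
  shows "\<exists>x\<in>K'. \<exists>y\<in>K'. x ^ k + y ^ k = c"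
proof (cases "c = 0")
  case True
  obtain w where "w \<in> K'" "w ^ k = -1" using even by (auto simp: H_def)
  with True show ?thesis by (intro bexI[of _ w] bexI[of _ 1]) auto
next
  case False
  with c have c': "c \<in> K'" by simp
  define s where "s = sqrt q"
  have s2: "real q = s * s" by (simp add: s_def)
  have "(real k - 1) ^ 4 \<ge> 0" "real k \<ge> 1" using k_pos by simp_all
  then have "4 \<le> real q" using q by linarith
  then have "2 \<le> s" unfolding s_def by (intro real_le_rsqrt) simp
  have "E ^ 4 \<le> (real k - 1) ^ 4" using E_nonneg E_le by (intro power_mono)
  then have E4: "(E\<^sup>2)\<^sup>2 + 4 * (E + 1) < q" using q E_le by simp
  then have "(E\<^sup>2)\<^sup>2 < q" using E_nonneg by simp
  then have Es: "E\<^sup>2 < s" unfolding s_def by (rule real_less_rsqrt)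
  \<comment> \<open>Twice s (s - E^2) is at least (s + E^2) (s - E^2) = q - E^4 > 4 (E + 1); half of
    this is the required 2 D.\<close>
  have "E\<^sup>2 * (s - E\<^sup>2) \<le> s * (s - E\<^sup>2)" using Es by (intro mult_right_mono) auto
  moreover have "s * s - (E\<^sup>2)\<^sup>2 = s * (s - E\<^sup>2) + E\<^sup>2 * (s - E\<^sup>2)"
    by (simp add: algebra_simps power2_eq_square)
  ultimately have pos: "s * (s - E\<^sup>2) > 2 * (E + 1)" using E4 unfolding s2 by linarith
  have "E * (s / 2 - 1) \<ge> 0" using \<open>2 \<le> s\<close> E_nonneg by simp
  moreover have "q - E * (E - 1 / 2) * s - E = s * (s - E\<^sup>2) + E * (s / 2 - 1)"
    unfolding s2 by (simp add: algebra_simps power2_eq_square)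
  ultimately have "q - E * (E - 1 / 2) * s - E > 2 * (E + 1)" using pos by linarith
  then have "real (N c) > 2 * D" using N_ge_if_minus_one_power[OF c' even] by (simp add: s_def E_def)
  then have N: "N c > 2 * D" by (simp only: of_nat_less_iff)
  show ?thesis
  proof (rule ccontr)
    assume none: "\<not> ?thesis"
    define Y where "Y = {y \<in> K. y ^ k = c}"
    have "{(x,y) \<in> K \<times> K. x ^ k + y ^ k = c} \<subseteq> Pair 0 ` Y \<union> (\<lambda>x. (x, 0)) ` Y"
    proof clarify
      fix x y assume xy: "x \<in> K" "y \<in> K" "c = x ^ k + y ^ k" "(x, y) \<notin> (\<lambda>x. (x, 0)) ` Y"
      have "x = 0 \<or> y = 0" using none xy(1-3) in_K' by metis
      moreover have "y \<noteq> 0" using xy k_pos by (auto simp: Y_def power_0_left)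
      ultimately show "(x, y) \<in> Pair 0 ` Y" using xy k_pos by (auto simp: Y_def power_0_left)
    qed
    then have "N c \<le> card (Pair 0 ` Y \<union> (\<lambda>x. (x, 0)) ` Y)"
      unfolding N_def by (intro card_mono) (auto simp: Y_def)
    also have "\<dots> \<le> card (Pair (0::'a) ` Y) + card ((\<lambda>x. (x, 0::'a)) ` Y)" by (rule card_Un_le)
    also have "\<dots> \<le> card Y + card Y" by (intro add_mono card_image_le) (auto simp: Y_def)
    also have "\<dots> \<le> 2 * D" using card_power_eq_le[of c] by (simp add: Y_def)
    finally show False using N by simp
  qed
qed

end

section \<open>The field with \<open>p ^ n\<close> elements\<close>

text \<open>Vanishing of the coefficients from \<open>m\<close> on, instead of a degree bound,
  treats the zero polynomial and \<open>m = 0\<close> uniformly.\<close>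

lemma card_polys_bounded_degree:
  "finite {g :: 'a::{finite,comm_ring_1} poly. \<forall>i\<ge>m. coeff g i = 0}"
  "card {g :: 'a::{finite,comm_ring_1} poly. \<forall>i\<ge>m. coeff g i = 0} = CARD('a) ^ m"
proof -
  let ?P = "\<lambda>m. {g :: 'a poly. \<forall>i\<ge>m. coeff g i = 0}"
  have "finite (?P m) \<and> card (?P m) = CARD('a) ^ m"
  proof (induction m)
    case 0
    have "?P 0 = {0}" by (auto simp: poly_eq_iff)
    then show ?case by simp
  next
    case (Suc m)
    have eq: "?P (Suc m) = (\<lambda>(a,g). pCons a g) ` (UNIV \<times> ?P m)"
    proof (intro equalityI subsetI)
      fix g assume g: "g \<in> ?P (Suc m)"
      obtain a h where "g = pCons a h" by (cases g)
      with g show "g \<in> (\<lambda>(a,g). pCons a g) ` (UNIV \<times> ?P m)"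
        by (intro image_eqI[of _ _ "(a, h)"]) (auto simp: coeff_pCons split: nat.splits)
    qed (auto simp: coeff_pCons split: nat.splits)
    have "inj_on (\<lambda>(a,g). pCons a g) (UNIV \<times> ?P m)" by (auto simp: inj_on_def)
    then show ?case unfolding eq using Suc by (simp add: card_image card_cartesian_product)
  qed
  then show "finite (?P m)" "card (?P m) = CARD('a) ^ m" by auto
qed

type_synonym 'p ac = "'p mod_ring alg_closure"

text \<open>The fixed points of the n-th iterate of Frobenius. For \<open>n = 0\<close> this is the
  whole closure, hence the assumption \<open>n > 0\<close> in what follows.\<close>

definition gf :: "nat \<Rightarrow> 'p::prime_card ac set" where
  "gf n = {x. x ^ (CARD('p) ^ n) = x}"

lemma prime_CHAR_ac: "Factorial_Ring.prime CHAR('p::prime_card ac)" and CHAR_ac: "CHAR('p::prime_card ac) = CARD('p)"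
  using prime_card[where ?'a = 'p] by simp_all

lemma frobenius_add: "(x + y) ^ (CARD('p) ^ n) = x ^ (CARD('p) ^ n) + y ^ (CARD('p) ^ n)"
  for x y :: "'p::prime_card ac"
  by (rule freshmans_dream'[OF prime_CHAR_ac]) (simp only: CHAR_ac)

lemma CARD_gt_1: "CARD('p::prime_card) > 1"
  using prime_card prime_gt_1_nat by blast

definition gf_poly :: "nat \<Rightarrow> 'p::prime_card ac poly" where
  "gf_poly n = monom 1 (CARD('p) ^ n) - monom 1 1"

context
  fixes n :: nat
  assumes n: "n > 0"
begin

lemma q_gt: "CARD('p::prime_card) ^ n > 1"
  by (rule one_less_power[OF CARD_gt_1 n])

lemma gf_poly_nonzero: "(gf_poly n :: 'p::prime_card ac poly) \<noteq> 0"
  and degree_gf_poly: "degree (gf_poly n :: 'p ac poly) = CARD('p) ^ n"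
proof -
  have c: "coeff (gf_poly n :: 'p ac poly) (CARD('p) ^ n) = 1"
    using q_gt[where ?'p = 'p] by (simp add: gf_poly_def)
  then show "(gf_poly n :: 'p ac poly) \<noteq> 0" by auto
  have "degree (gf_poly n :: 'p ac poly) \<le> CARD('p) ^ n"
    unfolding gf_poly_def
    by (rule degree_diff_le) (use q_gt[where ?'p = 'p] in \<open>auto simp: degree_monom_eq\<close>)
  moreover have "CARD('p) ^ n \<le> degree (gf_poly n :: 'p ac poly)"
    by (rule le_degree) (simp only: c one_neq_zero not_False_eq_True)
  ultimately show "degree (gf_poly n :: 'p ac poly) = CARD('p) ^ n" by simp
qed

lemma gf_eq_roots: "(gf n :: 'p::prime_card ac set) = {x. poly (gf_poly n) x = 0}"
  by (auto simp: gf_def gf_poly_def poly_monom)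

lemma finite_gf: "finite (gf n :: 'p::prime_card ac set)"
  and card_gf_le: "card (gf n :: 'p ac set) \<le> CARD('p) ^ n"
  using poly_roots_finite[OF gf_poly_nonzero[where ?'p = 'p]]
    poly_roots_degree[OF gf_poly_nonzero[where ?'p = 'p]]
  by (simp_all add: gf_eq_roots degree_gf_poly)

text \<open>The polynomial splits in the closure and has derivative -1, so its roots are simple and
  as many as its degree.\<close>

lemma card_gf: "card (gf n :: 'p::prime_card ac set) = CARD('p) ^ n"
proof -
  let ?f = "gf_poly n :: 'p ac poly"
  obtain A where A: "size A = degree ?f" "?f = smult (lead_coeff ?f) (\<Prod>x\<in>#A. [:-x, 1:])"
    using alg_closed_imp_factorization[OF gf_poly_nonzero[where ?'p = 'p]] by blast
  have "of_nat (CARD('p) ^ n) = (0 :: 'p ac)"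
    unfolding of_nat_eq_0_iff_char_dvd CHAR_ac using n by simp
  then have deriv: "pderiv ?f = -1"
    using n by (simp add: gf_poly_def pderiv_diff pderiv_monom monom_0 one_pCons power_0_left)
  have count: "count A x = 1" if x: "x \<in># A" for x
  proof (rule ccontr)
    assume "count A x \<noteq> 1"
    moreover have "count A x > 0" using x by simp
    ultimately have "count A x \<ge> 2" by linarith
    then have "{#x, x#} \<subseteq># A" by (simp add: subseteq_mset_def)
    then obtain B where "A = {#x, x#} + B" by (metis subset_mset.add_diff_inverse)
    then have "?f = [:-x, 1:] * ([:-x, 1:] * smult (lead_coeff ?f) (\<Prod>x\<in>#B. [:-x, 1:]))"
      using A(2) by (simp add: mult.assoc)
    then obtain h where "?f = [:-x, 1:] * ([:-x, 1:] * h)" by blast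
    then have "poly (pderiv ?f) x = 0" by (simp only: pderiv_mult poly_add poly_mult) simp
    then show False unfolding deriv by simp
  qed
  have "size A = (\<Sum>x\<in>set_mset A. count A x)" by (simp add: size_multiset_overloaded_eq)
  also have "\<dots> = card (set_mset A)" using count by simp
  also have "set_mset A = (gf n :: 'p ac set)"
  proof -
    have "lead_coeff ?f \<noteq> 0" using gf_poly_nonzero[where ?'p = 'p] by simp
    then have "poly ?f x = 0 \<longleftrightarrow> x \<in># A" for x
      by (subst A(2)) (auto simp: poly_prod_mset)
    then show ?thesis by (auto simp: gf_eq_roots)
  qed
  finally show ?thesis using A(1) degree_gf_poly[where ?'p = 'p] by simp
qed

lemma finite_subfield_gf: "finite_subfield (gf n :: 'p::prime_card ac set)"
proof
  show "finite (gf n :: 'p ac set)" by (rule finite_gf)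
  show "- x \<in> gf n" if "x \<in> gf n" for x :: "'p ac"
  proof -
    have "x ^ (CARD('p) ^ n) + (- x) ^ (CARD('p) ^ n) = 0"
      unfolding frobenius_add[symmetric] using q_gt[where ?'p = 'p] by (simp add: power_0_left)
    with that show ?thesis by (simp add: gf_def eq_neg_iff_add_eq_0 add.commute)
  qed
qed (use q_gt[where ?'p = 'p] in \<open>auto simp: gf_def frobenius_add power_mult_distrib power_inverse power_0_left\<close>)

end

lemma sum_powers_less: "(\<Sum>m<n. b ^ m) < b ^ n" if "b \<ge> 2" for b n :: nat
proof (induction n)
  case (Suc n)
  have "(\<Sum>m<Suc n. b ^ m) < 2 * b ^ n" using Suc by simp
  also have "\<dots> \<le> b ^ Suc n" using that by simp
  finally show ?case .
qed simp

text \<open>The smaller sets together have too few elements. All m below \<open>n\<close> are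
  excluded, not only divisors of \<open>n\<close>, because the degree of the minimal polynomial of
  \<alpha> will be compared with \<open>n\<close> before any divisibility is known.\<close>

lemma exists_not_in_smaller_gf:
  assumes "n > 0"
  obtains \<alpha> :: "'p::prime_card ac" where "\<alpha> \<in> gf n" "\<forall>m. 0 < m \<and> m < n \<longrightarrow> \<alpha> \<notin> gf m"
proof -
  let ?U = "\<Union>m\<in>{0<..<n}. (gf m :: 'p ac set)"
  have "finite ?U" using finite_gf by auto
  have "card ?U \<le> (\<Sum>m\<in>{0<..<n}. card (gf m :: 'p ac set))" by (rule card_UN_le) simp
  also have "\<dots> \<le> (\<Sum>m\<in>{0<..<n}. CARD('p) ^ m)" by (rule sum_mono) (auto intro: card_gf_le)
  also have "\<dots> \<le> (\<Sum>m<n. CARD('p) ^ m)" by (rule sum_mono2) auto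
  also have "\<dots> < CARD('p) ^ n" using CARD_gt_1[where ?'p = 'p] by (intro sum_powers_less) simp
  also have "\<dots> = card (gf n :: 'p ac set)" using card_gf[OF assms, where ?'p = 'p] by simp
  finally have "\<not> gf n \<subseteq> ?U" using card_mono[OF \<open>finite ?U\<close>] by (meson not_le)
  then obtain \<alpha> :: "'p ac" where "\<alpha> \<in> gf n" "\<alpha> \<notin> ?U" by blast
  then show ?thesis by (intro that[of \<alpha>]) auto
qed

lemma to_ac_in_gf: "to_ac (a :: 'p::prime_card mod_ring) \<in> gf n"
proof -
  have "of_nat i ^ (CARD('p) ^ n) = (of_nat i :: 'p ac)" for i
    by (induction i) (simp_all add: frobenius_add power_0_left)
  moreover obtain i where "a = of_nat i" using surj_of_nat_mod_ring[of a] by blast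
  ultimately show ?thesis by (simp add: gf_def)
qed

section \<open>A generator over the prime field and its minimal polynomial\<close>

definition eval_ac :: "'p::prime_card ac \<Rightarrow> 'p mod_ring poly \<Rightarrow> 'p ac" where
  "eval_ac \<alpha> g = poly (map_poly to_ac g) \<alpha>"

lemma eval_ac_0 [simp]: "eval_ac \<alpha> 0 = 0"
  by (simp add: eval_ac_def)

lemma eval_ac_pCons [simp]: "eval_ac \<alpha> (pCons a g) = to_ac a + \<alpha> * eval_ac \<alpha> g"
proof -
  have "map_poly to_ac (pCons a g) = pCons (to_ac a) (map_poly to_ac g)"
    by (rule poly_eqI) (simp add: coeff_map_poly coeff_pCons split: nat.splits)
  then show ?thesis by (simp add: eval_ac_def)
qed

lemma eval_ac_1 [simp]: "eval_ac \<alpha> 1 = 1"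
  by (simp add: one_pCons)

lemma eval_ac_add [simp]: "eval_ac \<alpha> (g + h) = eval_ac \<alpha> g + eval_ac \<alpha> h"
  by (induction g h rule: poly_induct2) (simp_all add: algebra_simps)

lemma eval_ac_smult [simp]: "eval_ac \<alpha> (smult c g) = to_ac c * eval_ac \<alpha> g"
  by (induction g) (simp_all add: algebra_simps)

lemma eval_ac_mult [simp]: "eval_ac \<alpha> (g * h) = eval_ac \<alpha> g * eval_ac \<alpha> h"
  by (induction g) (simp_all add: algebra_simps)

lemma eval_ac_diff [simp]: "eval_ac \<alpha> (g - h) = eval_ac \<alpha> g - eval_ac \<alpha> h"
  using eval_ac_add[of \<alpha> "g - h" h] by (simp add: algebra_simps)

lemma eval_ac_power [simp]: "eval_ac \<alpha> (g ^ k) = eval_ac \<alpha> g ^ k"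
  by (induction k) simp_all

lemma eval_ac_in_gf:
  assumes "n > 0" "\<alpha> \<in> gf n"
  shows "eval_ac \<alpha> g \<in> gf n"
proof -
  interpret finite_subfield "gf n :: 'a ac set" by (rule finite_subfield_gf) fact
  show ?thesis using assms by (induction g) (auto intro: to_ac_in_gf)
qed

text \<open>The powers of \<open>\<alpha>\<close> span a finite ring that is mapped bijectively to itself by
  multiplication with \<open>\<alpha>\<close>; with \<open>m\<close> the degree of the minimal polynomial this gives
  \<open>\<alpha> ^ (p ^ m - 1) = 1\<close>, and \<open>m = n\<close> by the choice of \<open>\<alpha>\<close>.\<close>

lemma minimal_polynomial_of_generator:
  assumes n: "n \<ge> 2"
  obtains \<alpha> :: "'p::prime_card ac" and f :: "'p mod_ring poly" where
    "degree f = n" "f \<noteq> 0" "\<forall>g. eval_ac \<alpha> g = 0 \<longleftrightarrow> f dvd g"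
    "bij_betw (eval_ac \<alpha>) {g. \<forall>i\<ge>n. coeff g i = 0} (gf n)"
proof -
  let ?p = "CARD('p)"
  let ?P = "\<lambda>m. {g :: 'p mod_ring poly. \<forall>i\<ge>m. coeff g i = 0}"
  have n0: "n > 0" using n by simp
  obtain \<alpha> :: "'p ac" where \<alpha>: "\<alpha> \<in> gf n" "\<forall>m. 0 < m \<and> m < n \<longrightarrow> \<alpha> \<notin> gf m"
    using exists_not_in_smaller_gf[OF n0] .
  \<comment> \<open>Zero lies in \<open>gf 1\<close>, which is among the excluded sets because
    \<open>n \<ge> 2\<close>.\<close>
  have \<alpha>0: "\<alpha> \<noteq> 0"
  proof
    assume "\<alpha> = 0"
    then have "\<alpha> \<in> gf 1" by (simp add: gf_def power_0_left)
    with \<alpha>(2) n show False by auto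
  qed
  have gf: "eval_ac \<alpha> g \<in> gf n" for g by (rule eval_ac_in_gf[OF n0 \<alpha>(1)])
  \<comment> \<open>Pigeonhole: p^(n + 1) polynomials have at most p^n values at \<alpha>, so the
    difference of two of them annihilates \<alpha>.\<close>
  have "\<not> inj_on (eval_ac \<alpha>) (?P (Suc n))"
  proof
    assume "inj_on (eval_ac \<alpha>) (?P (Suc n))"
    then have "card (?P (Suc n)) \<le> card (gf n :: 'p ac set)"
      using gf by (intro card_inj_on_le[of "eval_ac \<alpha>"] finite_gf[OF n0]) auto
    then have "?p ^ Suc n \<le> ?p ^ n"
      using card_polys_bounded_degree(2)[of "Suc n", where ?'a = "'p mod_ring"] card_gf[OF n0, where ?'p = 'p] by simp
    moreover have "?p ^ n < ?p ^ Suc n" by (rule power_strict_increasing[OF _ CARD_gt_1]) simp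
    ultimately show False by simp
  qed
  then obtain g h where "g \<noteq> h" "eval_ac \<alpha> g = eval_ac \<alpha> h" by (auto simp: inj_on_def)
  then have "g - h \<noteq> 0 \<and> eval_ac \<alpha> (g - h) = 0" by simp
  from ex_has_least_nat[of "\<lambda>f. f \<noteq> 0 \<and> eval_ac \<alpha> f = 0", OF this, of degree]
  obtain f where f: "f \<noteq> 0" "eval_ac \<alpha> f = 0"
    and least: "\<And>g. g \<noteq> 0 \<Longrightarrow> eval_ac \<alpha> g = 0 \<Longrightarrow> degree f \<le> degree g" by blast
  have eval_mod: "eval_ac \<alpha> (g mod f) = eval_ac \<alpha> g" for g
  proof -
    have "eval_ac \<alpha> g = eval_ac \<alpha> (g div f * f + g mod f)" by (simp only: div_mult_mod_eq)
    also have "\<dots> = eval_ac \<alpha> (g mod f)" unfolding eval_ac_add eval_ac_mult f(2) by simp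
    finally show ?thesis by simp
  qed
  have dvd: "eval_ac \<alpha> g = 0 \<longleftrightarrow> f dvd g" for g
  proof
    assume "eval_ac \<alpha> g = 0"
    then have "g mod f = 0"
      using eval_mod[of g] least[of "g mod f"] degree_mod_less[OF f(1), of g] by (metis not_le)
    then show "f dvd g" by (simp add: mod_eq_0_iff_dvd)
  qed (use f in auto)
  define m where "m = degree f"
  have "m > 0"
  proof (rule ccontr)
    assume "\<not> m > 0"
    then obtain a where "f = [:a:]" by (auto simp: m_def elim: degree_eq_zeroE)
    with f show False by simp
  qed
  have less: "g = 0 \<or> degree g < m" if "g \<in> ?P m" for g
    using that leading_coeff_0_iff[of g] by (metis (mono_tags, lifting) leI mem_Collect_eq)
  have inj: "inj_on (eval_ac \<alpha>) (?P m)"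
  proof (rule inj_onI)
    fix g h assume gh: "g \<in> ?P m" "h \<in> ?P m" "eval_ac \<alpha> g = eval_ac \<alpha> h"
    then have "g - h \<in> ?P m" "f dvd g - h" by (auto simp flip: dvd)
    with less[of "g - h"] show "g = h"
      using dvd_imp_degree_le[of f "g - h"] unfolding m_def by (metis not_le right_minus_eq)
  qed
  define F where "F = eval_ac \<alpha> ` ?P m"
  have finF: "finite F" and cardF: "card F = ?p ^ m"
    using card_polys_bounded_degree[of m, where ?'a = "'p mod_ring"] inj
    by (simp_all add: F_def card_image)
  have F_all: "eval_ac \<alpha> g \<in> F" for g
  proof -
    have "coeff (g mod f) i = 0" if "i \<ge> m" for i
      using degree_mod_less[OF f(1), of g] that by (auto simp: m_def intro: coeff_eq_0)
    then show ?thesis unfolding F_def using eval_mod[of g] by (intro image_eqI[of _ _ "g mod f"]) auto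
  qed
  have "0 \<in> F" using F_all[of 0] by simp
  have "\<alpha> * x \<in> F" if "x \<in> F" for x
  proof -
    from that obtain g where "x = eval_ac \<alpha> g" by (auto simp: F_def)
    then show ?thesis using F_all[of "pCons 0 g"] by simp
  qed
  then have sub: "(\<lambda>x. \<alpha> * x) ` (F - {0}) \<subseteq> F - {0}" using \<alpha>0 by auto
  have injm: "inj_on (\<lambda>x. \<alpha> * x) (F - {0})" using \<alpha>0 by (auto simp: inj_on_def)
  then have "(\<lambda>x. \<alpha> * x) ` (F - {0}) = F - {0}"
    using sub finF by (intro endo_inj_surj) auto
  then have "(\<Prod>x\<in>F - {0}. x) = (\<Prod>x\<in>F - {0}. \<alpha> * x)"
    using prod.reindex[OF injm, of "\<lambda>x. x"] by simp
  also have "\<dots> = \<alpha> ^ (?p ^ m - 1) * (\<Prod>x\<in>F - {0}. x)"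
    using \<open>0 \<in> F\<close> finF by (simp add: prod.distrib cardF)
  finally have "1 * (\<Prod>x\<in>F - {0}. x) = \<alpha> ^ (?p ^ m - 1) * (\<Prod>x\<in>F - {0}. x)" by simp
  moreover have "(\<Prod>x\<in>F - {0}. x) \<noteq> 0" using finF by simp
  ultimately have "\<alpha> ^ (?p ^ m - 1) = 1" by (metis mult_right_cancel)
  moreover have "?p ^ m = Suc (?p ^ m - 1)" by simp
  ultimately have "\<alpha> ^ (?p ^ m) = \<alpha>" by (metis power_Suc mult.right_neutral)
  then have "\<alpha> \<in> gf m" by (simp add: gf_def)
  with \<alpha>(2) \<open>m > 0\<close> have "n \<le> m" by (meson not_le)
  have Fsub: "F \<subseteq> gf n" using gf by (auto simp: F_def)
  then have "?p ^ m \<le> ?p ^ n"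
    using card_mono[OF finite_gf[OF n0] Fsub] cardF card_gf[OF n0, where ?'p = 'p] by simp
  then have "m \<le> n" using power_le_imp_le_exp[OF CARD_gt_1] by blast
  with \<open>n \<le> m\<close> have mn: "m = n" by simp
  then have "F = gf n"
    using Fsub cardF card_gf[OF n0, where ?'p = 'p] by (intro card_subset_eq[OF finite_gf[OF n0]]) auto
  then have "bij_betw (eval_ac \<alpha>) (?P n) (gf n)"
    using inj by (simp add: bij_betw_def F_def mn)
  with mn f dvd show ?thesis by (intro that[of f \<alpha>]) (auto simp: m_def)
qed

section \<open>Scalar matrices\<close>

definition mod_ring_char :: "'p::prime_card mod_ring \<Rightarrow> complex" where
  "mod_ring_char a = cis (2 * pi * of_int (to_int_mod_ring a) / CARD('p))"

lemma mod_ring_char_add: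
  "mod_ring_char (a + b) = mod_ring_char a * mod_ring_char (b :: 'p::prime_card mod_ring)"
proof -
  define s where "s = to_int_mod_ring a + to_int_mod_ring b"
  define t where "t = s div int CARD('p)"
  have "to_int_mod_ring (a + b) = s mod int CARD('p)"
    by (simp add: s_def to_int_mod_ring_add)
  also have "\<dots> = s - int CARD('p) * t"
    by (simp add: t_def minus_mult_div_eq_mod)
  finally have eq: "real_of_int (to_int_mod_ring (a + b)) = of_int s - real CARD('p) * of_int t"
    by (simp only: of_int_diff of_int_mult of_int_of_nat_eq)
  have "2 * pi * real_of_int (to_int_mod_ring (a + b)) / CARD('p) =
      2 * pi * of_int s / CARD('p) + 2 * pi * of_int (- t)"
    unfolding eq by (simp add: field_simps)
  then have "mod_ring_char (a + b) = cis (2 * pi * of_int s / CARD('p)) * cis (2 * pi * of_int (- t))"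
    by (simp only: mod_ring_char_def cis_mult)
  also have "cis (2 * pi * of_int (- t)) = 1" by (rule cis_multiple_2pi) simp
  also have "cis (2 * pi * of_int s / CARD('p)) = mod_ring_char a * mod_ring_char b"
    by (simp add: mod_ring_char_def cis_mult s_def field_simps)
  finally show ?thesis by simp
qed

lemma mod_ring_char_1: "mod_ring_char (1 :: 'p::prime_card mod_ring) \<noteq> 1"
proof
  assume "mod_ring_char (1 :: 'p mod_ring) = 1"
  moreover have "to_int_mod_ring (1 :: 'p mod_ring) = 1" by (transfer) simp
  ultimately have "cos (2 * pi / CARD('p)) = 1"
    by (simp add: mod_ring_char_def complex_eq_iff)
  then obtain x :: int where "2 * pi / CARD('p) = x * 2 * pi"
    by (auto simp: cos_one_2pi_int)
  then have "1 = real_of_int (x * int CARD('p))"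
    by (simp add: field_simps)
  then have "x * int CARD('p) = 1" by linarith
  then have "int CARD('p) dvd 1" by (metis dvd_triv_right)
  then show False using CARD_gt_1[where ?'p = 'p] by simp
qed

text \<open>The matrix of multiplication by \<open>g\<close> on the quotient ring modulo
  \<open>f\<close>, in the basis of monomials of degree below \<open>n\<close>.\<close>

definition regular_rep :: "nat \<Rightarrow> 'a::field poly \<Rightarrow> 'a poly \<Rightarrow> 'a mat" where
  "regular_rep n f g = mat n n (\<lambda>(i,j). coeff (g * monom 1 j mod f) i)"

lemma poly_eq_sum_monoms:
  fixes r :: "'a::comm_semiring_1 poly"
  assumes "\<And>i. i \<ge> n \<Longrightarrow> coeff r i = 0"
  shows "r = (\<Sum>l<n. smult (coeff r l) (monom 1 l))"
proof (rule poly_eqI)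
  fix i
  have "coeff (\<Sum>l<n. smult (coeff r l) (monom 1 l)) i = (\<Sum>l<n. if l = i then coeff r i else 0)"
    unfolding coeff_sum by (rule sum.cong) auto
  then show "coeff r i = coeff (\<Sum>l<n. smult (coeff r l) (monom 1 l)) i"
    using assms[of i] by auto
qed

context
  fixes f :: "'a::field poly" and n :: nat
  assumes f: "degree f = n" "n > 0"
begin

lemma f_nonzero: "f \<noteq> 0"
  using f by auto

lemma coeff_mod_eq_0: "i \<ge> n \<Longrightarrow> coeff (g mod f) i = 0"
  using degree_mod_less[OF f_nonzero, of g] f by (auto intro: coeff_eq_0)

lemma regular_rep_carrier [simp]: "regular_rep n f g \<in> carrier_mat n n"
  by (simp add: regular_rep_def)

lemma regular_rep_add: "regular_rep n f (g + h) = regular_rep n f g + regular_rep n f h"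
  by (rule eq_matI) (auto simp: regular_rep_def distrib_right poly_mod_add_left)

lemma regular_rep_const: "regular_rep n f [:c:] = c \<cdot>\<^sub>m 1\<^sub>m n"
proof (rule eq_matI)
  fix i j assume "i < dim_row (c \<cdot>\<^sub>m 1\<^sub>m n :: 'a mat)" "j < dim_col (c \<cdot>\<^sub>m 1\<^sub>m n :: 'a mat)"
  then have ij: "i < n" "j < n" by auto
  have "[:c:] * monom 1 j mod f = monom c j"
    using ij f by (cases "c = 0") (auto simp: smult_monom degree_monom_eq intro!: mod_poly_less)
  with ij show "regular_rep n f [:c:] $$ (i,j) = (c \<cdot>\<^sub>m 1\<^sub>m n) $$ (i,j)"
    by (auto simp: regular_rep_def)
qed (auto simp: regular_rep_def)

lemma regular_rep_mult: "regular_rep n f (g * h) = regular_rep n f g * regular_rep n f h"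
proof (rule eq_matI)
  fix i j assume "i < dim_row (regular_rep n f g * regular_rep n f h)"
    "j < dim_col (regular_rep n f g * regular_rep n f h)"
  then have ij: "i < n" "j < n" by (auto simp: regular_rep_def)
  define r where "r = h * monom 1 j mod f"
  have mod_sum: "(\<Sum>l\<in>A. u l) mod f = (\<Sum>l\<in>A. u l mod f)" for A and u :: "nat \<Rightarrow> 'a poly"
    by (induction A rule: infinite_finite_induct) (auto simp: poly_mod_add_left)
  have "r = (\<Sum>l<n. smult (coeff r l) (monom 1 l))"
    by (rule poly_eq_sum_monoms) (simp add: r_def coeff_mod_eq_0)
  then have "g * r mod f = (\<Sum>l<n. smult (coeff r l) (g * monom 1 l)) mod f"
    by (metis (no_types, lifting) mult_smult_right sum.cong sum_distrib_left)
  also have "\<dots> = (\<Sum>l<n. smult (coeff r l) (g * monom 1 l mod f))"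
    by (simp add: mod_sum mod_smult_left)
  finally have "coeff (g * r mod f) i = (\<Sum>l<n. coeff r l * coeff (g * monom 1 l mod f) i)"
    by (simp add: coeff_sum)
  moreover have "g * h * monom 1 j mod f = g * r mod f"
    unfolding r_def by (simp add: mod_mult_right_eq mult.assoc)
  ultimately show "regular_rep n f (g * h) $$ (i,j) = (regular_rep n f g * regular_rep n f h) $$ (i,j)"
    using ij by (simp add: regular_rep_def scalar_prod_def r_def atLeast0LessThan mult.commute)
qed (auto simp: regular_rep_def)

lemma regular_rep_1: "regular_rep n f 1 = 1\<^sub>m n"
  using regular_rep_const[of 1] by (auto simp: one_pCons intro!: eq_matI)

lemma regular_rep_power: "regular_rep n f (g ^ k) = regular_rep n f g ^\<^sub>m k"
proof (induction k)
  case 0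
  have "dim_row (regular_rep n f g) = n" by (simp add: regular_rep_def)
  then show ?case by (simp only: pow_mat.simps power_0 regular_rep_1)
next
  case (Suc k)
  then show ?case by (simp add: regular_rep_mult mult.commute[of g])
qed

lemma regular_rep_cong: "f dvd g - h \<Longrightarrow> regular_rep n f g = regular_rep n f h"
proof -
  assume "f dvd g - h"
  then have "g mod f = h mod f" by (simp add: mod_eq_dvd_iff)
  then have "g * monom 1 j mod f = h * monom 1 j mod f" for j by (metis mod_mult_left_eq)
  then show ?thesis by (simp add: regular_rep_def)
qed

end

text \<open>A representation of the scalar \<open>c\<close> as a sum of two powers in \<open>gf n\<close> is transported to
  matrices by the regular representation of \<open>gf n\<close> over the prime field.\<close>

lemma scalar_sum_of_powers:
  fixes c :: "'p::prime_card mod_ring"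
  assumes n: "n \<ge> 2" and xy: "x \<in> gf n" "y \<in> gf n" "x ^ k + y ^ k = to_ac c"
  obtains A B where "A \<in> carrier_mat n n" "B \<in> carrier_mat n n" "c \<cdot>\<^sub>m 1\<^sub>m n = A ^\<^sub>m k + B ^\<^sub>m k"
    "x \<noteq> 0 \<longrightarrow> invertible_mat A" "y \<noteq> 0 \<longrightarrow> invertible_mat B"
proof -
  have n0: "n > 0" using n by simp
  interpret finite_subfield "gf n :: 'p ac set" by (rule finite_subfield_gf[OF n0])
  obtain \<alpha> :: "'p ac" and f :: "'p mod_ring poly" where f: "degree f = n" "f \<noteq> 0"
    and "\<forall>g. eval_ac \<alpha> g = 0 \<longleftrightarrow> f dvd g"
    and bij: "bij_betw (eval_ac \<alpha>) {g. \<forall>i\<ge>n. coeff g i = 0} (gf n)"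
    using minimal_polynomial_of_generator[OF n, where ?'p = 'p] .
  then have dvd: "eval_ac \<alpha> g = 0 \<longleftrightarrow> f dvd g" for g by blast
  have surj: "\<exists>g. eval_ac \<alpha> g = z" if "z \<in> gf n" for z
    using that unfolding bij_betw_imp_surj_on[OF bij, symmetric] by auto
  note rep = regular_rep_carrier[OF f(1) n0] regular_rep_mult[OF f(1) n0] regular_rep_1[OF f(1) n0]
  have inv: "invertible_mat (regular_rep n f g)" if g: "eval_ac \<alpha> g \<noteq> 0" "eval_ac \<alpha> g \<in> gf n" for g
  proof -
    \<comment> \<open>A polynomial representing the inverse of g(\<alpha>): \<open>g * h - 1\<close>
      vanishes at \<alpha>, hence is divisible by \<open>f\<close>, and the representation sends
      \<open>h\<close> to the inverse matrix.\<close>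
    obtain h where h: "eval_ac \<alpha> h = inverse (eval_ac \<alpha> g)" using surj[of "inverse (eval_ac \<alpha> g)"] g by auto
    then have "f dvd g * h - 1" "f dvd h * g - 1" using g(1) by (simp_all flip: dvd)
    then have "regular_rep n f g * regular_rep n f h = 1\<^sub>m n" "regular_rep n f h * regular_rep n f g = 1\<^sub>m n"
      using regular_rep_cong[OF f(1) n0] by (metis rep(2,3))+
    then show ?thesis using rep(1) by (intro invertible_matI[of _ n]) auto
  qed
  obtain g h where gh: "eval_ac \<alpha> g = x" "eval_ac \<alpha> h = y" using surj xy by metis
  then have "f dvd [:c:] - (g ^ k + h ^ k)" using xy by (simp flip: dvd)
  then have "regular_rep n f [:c:] = regular_rep n f (g ^ k + h ^ k)" by (rule regular_rep_cong[OF f(1) n0])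
  then have "c \<cdot>\<^sub>m 1\<^sub>m n = regular_rep n f g ^\<^sub>m k + regular_rep n f h ^\<^sub>m k"
    by (simp add: regular_rep_const[OF f(1) n0] regular_rep_add[OF f(1) n0] regular_rep_power[OF f(1) n0])
  then show ?thesis
    using inv[of g] inv[of h] gh xy by (intro that[of "regular_rep n f g" "regular_rep n f h"]) (auto simp: rep)
qed

text \<open>The constant coefficient with respect to the powers of the generator is a linear
  functional over the prime field with value 1 at 1; composing it with the character of the prime
  field gives a nontrivial character.\<close>

lemma exists_additive_character_gf:
  assumes n: "n \<ge> 2" and k: "k > 0"
  shows "\<exists>\<psi>. additive_character (gf n :: 'p::prime_card ac set) k \<psi>"
proof -
  have n0: "n > 0" using n by simp
  interpret finite_subfield "gf n :: 'p ac set" by (rule finite_subfield_gf[OF n0])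
  let ?P = "{g :: 'p mod_ring poly. \<forall>i\<ge>n. coeff g i = 0}"
  obtain \<alpha> :: "'p ac" and f :: "'p mod_ring poly" where
    "degree f = n" "f \<noteq> 0" "\<forall>g. eval_ac \<alpha> g = 0 \<longleftrightarrow> f dvd g" and
    bij: "bij_betw (eval_ac \<alpha>) ?P (gf n)"
    using minimal_polynomial_of_generator[OF n, where ?'p = 'p] .
  define r where "r = inv_into ?P (eval_ac \<alpha>)"
  have r: "r x \<in> ?P" "eval_ac \<alpha> (r x) = x" if "x \<in> gf n" for x
    unfolding r_def using bij_betw_imp_surj_on[OF bij] that
      inv_into_into[of x "eval_ac \<alpha>" ?P] f_inv_into_f[of x "eval_ac \<alpha>" ?P] by blast+
  have r_eq: "r (eval_ac \<alpha> g) = g" if "g \<in> ?P" for g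
    unfolding r_def using bij that by (intro inv_into_f_f) (auto simp: bij_betw_def)
  define \<psi> where "\<psi> x = mod_ring_char (coeff (r x) 0)" for x
  have "additive_character (gf n) k \<psi>"
  proof
    show "k > 0" by fact
    show "\<psi> (x + y) = \<psi> x * \<psi> y" if "x \<in> gf n" "y \<in> gf n" for x y
    proof -
      have "r x + r y \<in> ?P" using r(1)[OF that(1)] r(1)[OF that(2)] by simp
      from r_eq[OF this] have "r (x + y) = r x + r y" using r(2) that by simp
      then show ?thesis by (simp add: \<psi>_def mod_ring_char_add)
    qed
    show "norm (\<psi> x) = 1" for x by (simp add: \<psi>_def mod_ring_char_def)
    have "1 \<in> ?P" using n by (auto simp: coeff_1)
    from r_eq[OF this] have "r 1 = 1" by simp
    then have "\<psi> 1 \<noteq> 1" by (simp add: \<psi>_def mod_ring_char_1)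
    then show "\<exists>z\<in>gf n. \<psi> z \<noteq> 1" by blast
  qed
  then show ?thesis by blast
qed

text \<open>Otherwise all p - 1 nonzero elements would be k-th roots of unity, of which there are at
  most gcd(k, p - 1) < p - 1.\<close>

lemma exists_power_not_0_1:
  assumes k: "k > 0" and gcd: "gcd k (CARD('p) - 1) + 1 < CARD('p::prime_card)"
  shows "\<exists>g :: 'p mod_ring. g ^ k \<noteq> 0 \<and> g ^ k \<noteq> 1"
proof (rule ccontr)
  assume "\<not> ?thesis"
  then have all: "g ^ k = 0 \<or> g ^ k = 1" for g :: "'p mod_ring" by blast
  interpret finite_subfield_power "UNIV :: 'p mod_ring set" k
    by unfold_locales (use k in auto)
  have q: "q = CARD('p)" by (simp add: q_def)
  have "K' \<subseteq> roots_of_unity"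
  proof
    fix x assume "x \<in> K'"
    with all[of x] show "x \<in> roots_of_unity" by (simp add: roots_of_unity_def)
  qed
  then have "card K' \<le> D" unfolding D_def by (rule card_mono[rotated]) simp
  then show False using D_le_gcd gcd by (simp add: card_K' q)
qed

lemma less_power_if_ln_less:
  fixes x :: real and p n :: nat
  assumes "x > 0" "p > 1" "ln x / ln p < n"
  shows "x < real p ^ n"
proof -
  have "ln x < ln (real p ^ n)" using assms by (simp add: ln_realpow pos_divide_less_eq)
  then show ?thesis using assms by (subst (asm) ln_less_cancel_iff) auto
qed

theorem theorem1p14:
  fixes p n k d d\<^sub>n :: nat
  assumes p: "p = CARD('p::prime_card)"
    and n: "n \<ge> 2"
    and k: "k \<ge> 1"
    and d: "d = gcd k (p - 1)"
    and dn: "d\<^sub>n = gcd k (p ^ n - 1)"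
    and p_gt: "p > d + 1"
    and p_ndvd: "\<not> p dvd k"
  shows
    "(ereal (real n) > max (ereal ((real p - 1) / 2))
                           (4 * ln_ext (real k - 1) / ln_ext (real p)) \<longrightarrow>
       (\<forall>M \<in> (carrier_mat n n :: 'p mod_ring mat set).
          \<exists>A \<in> carrier_mat n n. \<exists>B \<in> carrier_mat n n.
            M = A ^\<^sub>m k + B ^\<^sub>m k))
     \<and>
     (ereal (real n) > max (ereal ((real p - 1) / 2))
                           (ln_ext ((real k - 1) ^ 4 + 4 * real k) / ln_ext (real p)) \<and>
      even (p * ((p ^ n - 1) div d\<^sub>n)) \<longrightarrow>
       (\<forall>M \<in> (carrier_mat n n :: 'p mod_ring mat set).
          \<exists>A \<in> carrier_mat n n. \<exists>B \<in> carrier_mat n n.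
            invertible_mat A \<and> invertible_mat B \<and> M = A ^\<^sub>m k + B ^\<^sub>m k))"
proof -
  have "d > 0" using k d by simp
  then have p2: "p > 2" using p_gt by linarith
  have kF: "(of_nat k :: 'p mod_ring) \<noteq> 0"
    using p_ndvd p by (simp add: of_nat_eq_0_iff_char_dvd)
  have "(of_nat 2 :: 'p mod_ring) \<noteq> 0"
    unfolding of_nat_eq_0_iff_char_dvd using p2 p by (auto dest: dvd_imp_le)
  then have two: "(2 :: 'p mod_ring) \<noteq> 0" by simp
  have k0: "k > 0" and n0: "n > 0" using k n by auto
  obtain g :: "'p mod_ring" where g: "g ^ k \<noteq> 0" "g ^ k \<noteq> 1"
    using exists_power_not_0_1[OF k0, where ?'p = 'p] p_gt unfolding d p by blast
  have nonscalar: "\<exists>A \<in> carrier_mat n n. \<exists>B \<in> carrier_mat n n.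
      invertible_mat A \<and> invertible_mat B \<and> M = A ^\<^sub>m k + B ^\<^sub>m k"
    if M: "M \<in> carrier_mat n n" and ns: "\<And>c. M \<noteq> c \<cdot>\<^sub>m 1\<^sub>m n" and big: "(real p - 1) / 2 < real n"
    for M :: "'p mod_ring mat"
  proof -
    define t where "t = (\<Sum>i<n. M $$ (i,i))"
    \<comment> \<open>Any trace is reached with some residue \<open>j\<close> below
      \<open>p\<close>, and the bound on \<open>n\<close> makes \<open>j\<close> fit into the
      \<open>2 * n\<close> diagonal places.\<close>
    obtain j where j: "j < CARD('p)" "(t - of_nat (2 * n)) / (g ^ k - 1) = of_nat j"
      using surj_of_nat_mod_ring[of "(t - of_nat (2 * n)) / (g ^ k - 1)"] by blast
    have "t = of_nat (2 * n) + of_nat j * (g ^ k - 1)"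
      unfolding j(2)[symmetric] using g by simp
    moreover have "j \<le> 2 * n"
    proof -
      have "real p < 2 * real n + 1" using big by simp
      then show ?thesis using j(1) p by linarith
    qed
    ultimately obtain A B where "A \<in> carrier_mat n n" "B \<in> carrier_mat n n"
      "invertible_mat A" "invertible_mat B" "M = A ^\<^sub>m k + B ^\<^sub>m k"
      using nonscalar_sum_of_kth_powers[OF M ns two kF g, of j] unfolding t_def by auto
    then show ?thesis by auto
  qed
  obtain \<psi> where "additive_character (gf n :: 'p ac set) k \<psi>"
    using exists_additive_character_gf[OF n k0, where ?'p = 'p] by blast
  then interpret F: additive_character "gf n :: 'p ac set" k \<psi> .
  have q: "F.q = p ^ n" by (simp add: F.q_def card_gf[OF n0] p)
  have "4 \<le> p ^ 2" using p2 power_mono[of 2 p 2] by simp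
  also have "\<dots> \<le> p ^ n" using p2 n by (intro power_increasing) auto
  finally have q4: "F.q \<ge> 4" by (simp add: q)
  have ln_p: "ln_ext (real p) = ereal (ln (real p))" "ln (real p) > 0" using p2 by (auto simp: ln_ext_def)
  show ?thesis
  proof (intro conjI impI ballI)
    fix M :: "'p mod_ring mat"
    assume M: "M \<in> carrier_mat n n"
      and "max (ereal ((real p - 1) / 2)) (4 * ln_ext (real k - 1) / ln_ext (real p)) < ereal (real n)"
    then have big: "(real p - 1) / 2 < real n"
      and lnk: "4 * ln_ext (real k - 1) / ln_ext (real p) < ereal (real n)" by auto
    have "(real k - 1) ^ 4 < real F.q"
    \<comment> \<open>For \<open>k = 1\<close> the logarithmic bound is minus infinity and carries
      no information; the claim is then 0 < q.\<close>
    proof (cases "k = 1")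
      case False
      then have "real k - 1 > 0" using k by simp
      then have "4 * ln_ext (real k - 1) / ln_ext (real p) = ereal (ln ((real k - 1) ^ 4) / ln (real p))"
        using p2 by (simp add: ln_p ln_ext_def ln_realpow)
      then show ?thesis
        using less_power_if_ln_less[of "(real k - 1) ^ 4" p n] lnk p2 \<open>real k - 1 > 0\<close> by (simp add: q)
    qed (use q4 in simp)
    note sum = F.exists_sum_of_powers[OF to_ac_in_gf q4 this]
    show "\<exists>A \<in> carrier_mat n n. \<exists>B \<in> carrier_mat n n. M = A ^\<^sub>m k + B ^\<^sub>m k"
    proof (cases "\<exists>c. M = c \<cdot>\<^sub>m 1\<^sub>m n")
      case True
      then obtain c where c: "M = c \<cdot>\<^sub>m 1\<^sub>m n" by blast
      obtain x y :: "'p ac" where "x \<in> gf n" "y \<in> gf n" "x ^ k + y ^ k = to_ac c"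
        using sum[of c] by blast
      from scalar_sum_of_powers[OF n this]
      obtain A B where "A \<in> carrier_mat n n" "B \<in> carrier_mat n n" "c \<cdot>\<^sub>m 1\<^sub>m n = A ^\<^sub>m k + B ^\<^sub>m k" .
      then show ?thesis unfolding c by blast
    next
      case False
      with nonscalar[OF M _ big] show ?thesis by blast
    qed
  next
    fix M :: "'p mod_ring mat"
    assume M: "M \<in> carrier_mat n n"
      and "max (ereal ((real p - 1) / 2)) (ln_ext ((real k - 1) ^ 4 + 4 * real k) / ln_ext (real p)) <
          ereal (real n) \<and> even (p * ((p ^ n - 1) div d\<^sub>n))"
    then have big: "(real p - 1) / 2 < real n"
      and lnk: "ln_ext ((real k - 1) ^ 4 + 4 * real k) / ln_ext (real p) < ereal (real n)"
      and ev: "even (p * ((p ^ n - 1) div d\<^sub>n))" by auto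
    have "(real k - 1) ^ 4 \<ge> 0" by simp
    then have pos: "(real k - 1) ^ 4 + 4 * real k > 0" using k by linarith
    then have "(real k - 1) ^ 4 + 4 * real k < real F.q"
      using less_power_if_ln_less[of "(real k - 1) ^ 4 + 4 * real k" p n] lnk p2
      by (simp add: q ln_p ln_ext_def)
    \<comment> \<open>As \<open>p\<close> is odd, the parity hypothesis falls on the quotient of p^n
      - 1 by d_n, which puts -1 among the k-th powers.\<close>
    moreover have "odd p" using prime_card[where ?'a = 'p] p2 p by (metis prime_odd_nat)
    then have "-1 \<in> F.H" using ev by (intro F.minus_one_in_H) (simp add: q dn)
    ultimately have sum: "\<And>c. c \<in> gf n \<Longrightarrow> \<exists>x\<in>F.K'. \<exists>y\<in>F.K'. x ^ k + y ^ k = c"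
      using F.exists_sum_of_unit_powers by blast
    show "\<exists>A \<in> carrier_mat n n. \<exists>B \<in> carrier_mat n n.
        invertible_mat A \<and> invertible_mat B \<and> M = A ^\<^sub>m k + B ^\<^sub>m k"
    proof (cases "\<exists>c. M = c \<cdot>\<^sub>m 1\<^sub>m n")
      case True
      then obtain c where c: "M = c \<cdot>\<^sub>m 1\<^sub>m n" by blast
      obtain x y :: "'p ac" where xy: "x \<in> F.K'" "y \<in> F.K'" "x ^ k + y ^ k = to_ac c"
        using sum[OF to_ac_in_gf[of c]] by blast
      then have "x \<in> gf n" "y \<in> gf n" "x \<noteq> 0" "y \<noteq> 0" by auto
      moreover from scalar_sum_of_powers[OF n this(1,2) xy(3)]
      obtain A B where "A \<in> carrier_mat n n" "B \<in> carrier_mat n n" "c \<cdot>\<^sub>m 1\<^sub>m n = A ^\<^sub>m k + B ^\<^sub>m k"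
        "x \<noteq> 0 \<longrightarrow> invertible_mat A" "y \<noteq> 0 \<longrightarrow> invertible_mat B" .
      ultimately show ?thesis unfolding c by blast
    next
      case False
      with nonscalar[OF M _ big] show ?thesis by blast
    qed
  qed
qed

end
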